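(* For each $N\ge1$ let $\theta_i(\mathbf x,\mathbf p)$ denote the $\boldsymbol\theta$-components of $\omega^{-1}(\mathbf x,\mathbf p)$ and $$H_\psi(\mathbf x,\mathbf p)=\frac12\sum_{i=1}^N\theta_i(\mathbf x,\mathbf p)^2=\sum_{i=1}^N\frac{p_i^2}{2}+V_\psi(\mathbf x,\mathbf p).$$ Then $H_\psi\in C^1(\mathbb R^{2N})$ and the trajectories $t\mapsto\omega(\mathbf y+t\boldsymbol\theta,\boldsymbol\theta)$ are exactly the solutions of $\dot x_i=\{x_i,H_\psi\}$, $\dot p_i=\{p_i,H_\psi\}$. The functions $Q_a(\mathbf x,\mathbf p)=\sum_i\theta_i(\mathbf x,\mathbf p)^a$, $a=1,\dots,N$, are $C^1$, functionally independent, pairwise Poisson-commuting, and $H_\psi=\frac12 Q_2$; hence $H_\psi$ is Liouville integrable. Moreover the sequence $(H_\psi)_{N\ge1}$ is Liouville integrable with finite-range interaction of range $\epsilon$ with respect to the dispersion relations $E_a(p)=p^a$: writing $Q_a=\sum_ip_i^a+V_a$, each quasi-potential $V_a$ has finite range $\epsilon$ uniformly in $N$.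
   Context: Fix $\epsilon>0$ and $\psi\in C^2(\mathbb R^2)$ such that for all $(x,\theta)\in\mathbb R^2$: $\psi_{x\theta}(x,\theta)\ge 0$, $\psi(-x,-\theta)=\psi(x,\theta)$, and $\psi_x(x,\theta)=0$ whenever $|x|\ge\epsilon$. Phase space $\mathbb R^{2N}$ with canonical Poisson bracket $\{x_i,p_j\}=\delta_{ij}$, $\{x_i,x_j\}=\{p_i,p_j\}=0$. The map $\omega:(\mathbf y,\boldsymbol\theta)\mapsto(\mathbf x,\mathbf p)$ is defined by solving $y_i=x_i+\sum_{j\ne i}\psi_\theta(x_i-x_j,\theta_i-\theta_j)$ for $\mathbf x$ and then setting $p_i=\theta_i+\sum_{j\ne i}\psi_x(x_i-x_j,\theta_i-\theta_j)$; it is a $C^1$ diffeomorphism of $\mathbb R^{2N}$. Cluster partition: for $\mathbf x\in\mathbb R^N$, $P_\epsilon(\mathbf x)$ is the finest partition of $\{1,\dots,N\}$ such that $|x_i-x_j|>\epsilon$ whenever $i,j$ lie in different blocks (the blocks are the connected components of the graph joining $i,j$ when $|x_i-x_j|\le\epsilon$). For a block $I$, $\mathbf x_I=(x_i)_{i\in I}$ in increasing order of indices. Finite range: a function $V\in C^1(\mathbb R^{2N})$ has finite range $\epsilon$ if for every $n\in\{1,\dots,N\}$ there is $V^{(n)}\in C^1(\mathbb R^{2n})$ with $V^{(1)}\equiv0$ and $V(\mathbf x,\mathbf p)=\sum_{I\in P_\epsilon(\mathbf x)}V^{(|I|)}(\mathbf x_I,\mathbf p_I)$ for all $(\mathbf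 x,\mathbf p)$; "uniformly in $N$" means the functions $V^{(n)}$ can be chosen independent of $N$. A sequence of Hamiltonians $(H_N)_{N\ge1}$ is Liouville integrable with finite-range interaction if each $H_N$ is Liouville integrable and there are $E_a\in C^1(\mathbb R)$, independent of $N$, with $\sum_iE_a(p_i)$, $a=1..N$, functionally independent, such that the conserved quantities have the form $Q_a=\sum_iE_a(p_i)+V_a$ with all $V_a$ of finite range $\epsilon$ uniformly in $N$. *)

theory Defs
  imports "HOL-Analysis.Analysis"
begin

section \<open>Functions of two real variables: partial derivatives and C^2\<close>

definition pdx :: "(real \<Rightarrow> real \<Rightarrow> real) \<Rightarrow> real \<Rightarrow> real \<Rightarrow> real" where
  "pdx f x t = deriv (\<lambda>s. f s t) x"

definition pdt :: "(real \<Rightarrow> real \<Rightarrow> real) \<Rightarrow> real \<Rightarrow> real \<Rightarrow> real" where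
  "pdt f x t = deriv (\<lambda>s. f x s) t"

definition partials_exist :: "(real \<Rightarrow> real \<Rightarrow> real) \<Rightarrow> bool" where
  "partials_exist f \<longleftrightarrow>
     (\<forall>x t. (\<lambda>s. f s t) differentiable (at x) \<and> (\<lambda>s. f x s) differentiable (at t))"

text \<open>C^2 on R^2: all partial derivatives of order at most 2 exist everywhere and
  are continuous.\<close>
definition C2 :: "(real \<Rightarrow> real \<Rightarrow> real) \<Rightarrow> bool" where
  "C2 f \<longleftrightarrow> partials_exist f \<and> partials_exist (pdx f) \<and> partials_exist (pdt f) \<and>
     (\<forall>g \<in> {f, pdx f, pdt f, pdx (pdx f), pdt (pdx f), pdx (pdt f), pdt (pdt f)}.
        continuous_on UNIV (\<lambda>(x, t). g x t))"

section \<open>The phase space R^{2N}\<close>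

text \<open>A point of R^n is represented by a function nat => real vanishing at indices >= n;
  coordinates are indexed 0..n-1.  A phase space point is a pair (x, p).\<close>

definition sub :: "nat \<Rightarrow> (nat \<Rightarrow> real) set" where
  "sub n = {v. \<forall>k\<ge>n. v k = 0}"

type_synonym phasefun = "(nat \<Rightarrow> real) \<Rightarrow> (nat \<Rightarrow> real) \<Rightarrow> real"

definition enorm2 :: "nat \<Rightarrow> (nat \<Rightarrow> real) \<Rightarrow> (nat \<Rightarrow> real) \<Rightarrow> real" where
  "enorm2 n h q = sqrt (\<Sum>k<n. (h k)\<^sup>2 + (q k)\<^sup>2)"

text \<open>Frechet differentiability on R^{2n} at (x,p) with gradient (gx,gp).\<close>
definition has_grad :: "nat \<Rightarrow> phasefun \<Rightarrow> (nat \<Rightarrow> real) \<Rightarrow> (nat \<Rightarrow> real)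
    \<Rightarrow> (nat \<Rightarrow> real) \<Rightarrow> (nat \<Rightarrow> real) \<Rightarrow> bool" where
  "has_grad n F x p gx gp \<longleftrightarrow>
     ((\<lambda>(h, q). (F (\<lambda>k. x k + h k) (\<lambda>k. p k + q k) - F x p
                   - (\<Sum>k<n. gx k * h k + gp k * q k)) / enorm2 n h q)
       \<longlongrightarrow> 0) (at (\<lambda>_. 0, \<lambda>_. 0) within (sub n \<times> sub n))"

text \<open>F is C^1 on R^{2n}.\<close>
definition C1 :: "nat \<Rightarrow> phasefun \<Rightarrow> bool" where
  "C1 n F \<longleftrightarrow> (\<exists>gx gp :: (nat \<Rightarrow> real) \<Rightarrow> (nat \<Rightarrow> real) \<Rightarrow> nat \<Rightarrow> real.
     (\<forall>x\<in>sub n. \<forall>p\<in>sub n. has_grad n F x p (gx x p) (gp x p)) \<and>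
     (\<forall>k<n. continuous_on (sub n \<times> sub n) (\<lambda>(x, p). gx x p k) \<and>
            continuous_on (sub n \<times> sub n) (\<lambda>(x, p). gp x p k)))"

text \<open>Partial derivatives with respect to x_k and p_k.\<close>
definition pdX :: "phasefun \<Rightarrow> nat \<Rightarrow> (nat \<Rightarrow> real) \<Rightarrow> (nat \<Rightarrow> real) \<Rightarrow> real" where
  "pdX F k x p = deriv (\<lambda>s. F (x(k := s)) p) (x k)"

definition pdP :: "phasefun \<Rightarrow> nat \<Rightarrow> (nat \<Rightarrow> real) \<Rightarrow> (nat \<Rightarrow> real) \<Rightarrow> real" where
  "pdP F k x p = deriv (\<lambda>s. F x (p(k := s))) (p k)"

text \<open>Canonical Poisson bracket on R^{2n}: {x_i,p_j} = delta_ij.\<close>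
definition pbracket :: "nat \<Rightarrow> phasefun \<Rightarrow> phasefun \<Rightarrow> phasefun" where
  "pbracket n F G x p = (\<Sum>k<n. pdX F k x p * pdP G k x p - pdP F k x p * pdX G k x p)"

text \<open>Functional independence of Q_1..Q_n: differentials linearly independent on an
  open dense subset of R^{2n}.\<close>
definition func_indep :: "nat \<Rightarrow> (nat \<Rightarrow> phasefun) \<Rightarrow> bool" where
  "func_indep n Q \<longleftrightarrow> (\<exists>S. openin (top_of_set (sub n \<times> sub n)) S \<and>
      sub n \<times> sub n \<subseteq> closure S \<and>
      (\<forall>(x, p)\<in>S. \<forall>c :: nat \<Rightarrow> real.
         (\<forall>k<n. (\<Sum>a=1..n. c a * pdX (Q a) k x p) = 0 \<and> (\<Sum>a=1..n. c a * pdP (Q a) k x p) = 0)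
         \<longrightarrow> (\<forall>a\<in>{1..n}. c a = 0)))"

text \<open>Liouville integrability of H on R^{2n} with conserved quantities Q_1..Q_n.\<close>
definition liouville_with :: "nat \<Rightarrow> phasefun \<Rightarrow> (nat \<Rightarrow> phasefun) \<Rightarrow> bool" where
  "liouville_with n H Q \<longleftrightarrow> C1 n H \<and> (\<forall>a\<in>{1..n}. C1 n (Q a)) \<and> func_indep n Q \<and>
     (\<forall>a\<in>{1..n}. \<forall>b\<in>{1..n}. \<forall>x\<in>sub n. \<forall>p\<in>sub n. pbracket n (Q a) (Q b) x p = 0) \<and>
     (\<forall>a\<in>{1..n}. \<forall>x\<in>sub n. \<forall>p\<in>sub n. pbracket n (Q a) H x p = 0)"

definition liouville_integrable :: "nat \<Rightarrow> phasefun \<Rightarrow> bool" where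
  "liouville_integrable n H \<longleftrightarrow> (\<exists>Q. liouville_with n H Q)"

section \<open>Clusters and finite range\<close>

text \<open>The cluster partition P_eps(x) of {0..<N}: connected components of the graph
  joining i and j when |x_i - x_j| <= eps.\<close>
definition cluster_partition :: "real \<Rightarrow> nat \<Rightarrow> (nat \<Rightarrow> real) \<Rightarrow> nat set set" where
  "cluster_partition eps N x =
     {0..<N} // ({(i, j). i < N \<and> j < N \<and> \<bar>x i - x j\<bar> \<le> eps}\<^sup>*)"

text \<open>x_I: the entries of x indexed by I, in increasing order of indices, as a point
  of R^{card I}.\<close>
definition restr :: "nat set \<Rightarrow> (nat \<Rightarrow> real) \<Rightarrow> (nat \<Rightarrow> real)" where
  "restr I x = (\<lambda>k. if k < card I then x (sorted_list_of_set I ! k) else 0)"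

text \<open>V has finite range eps on R^{2N}, witnessed by the family W (W n = V^(n)).\<close>
definition finite_range_with :: "real \<Rightarrow> nat \<Rightarrow> phasefun \<Rightarrow> (nat \<Rightarrow> phasefun) \<Rightarrow> bool" where
  "finite_range_with eps N V W \<longleftrightarrow> C1 N V \<and>
     (\<forall>n\<in>{1..N}. C1 n (W n)) \<and>
     (\<forall>x\<in>sub 1. \<forall>p\<in>sub 1. W 1 x p = 0) \<and>
     (\<forall>x\<in>sub N. \<forall>p\<in>sub N.
        V x p = (\<Sum>I\<in>cluster_partition eps N x. W (card I) (restr I x) (restr I p)))"

definition finite_range :: "real \<Rightarrow> nat \<Rightarrow> phasefun \<Rightarrow> bool" where
  "finite_range eps N V \<longleftrightarrow> (\<exists>W. finite_range_with eps N V W)"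

definition real_C1 :: "(real \<Rightarrow> real) \<Rightarrow> bool" where
  "real_C1 f \<longleftrightarrow> (\<exists>f'. continuous_on UNIV f' \<and> (\<forall>t. (f has_real_derivative f' t) (at t)))"

text \<open>A sequence (H N) of Hamiltonians is Liouville integrable with finite-range interaction
  of range eps w.r.t. dispersion relations E a (a >= 1).  The family W a n = V_a^(n) is
  independent of N (uniformity in N).\<close>
definition liouville_finite_range :: "real \<Rightarrow> (nat \<Rightarrow> phasefun) \<Rightarrow> (nat \<Rightarrow> real \<Rightarrow> real) \<Rightarrow> bool" where
  "liouville_finite_range eps H E \<longleftrightarrow>
     (\<forall>a\<ge>1. real_C1 (E a)) \<and>
     (\<exists>W :: nat \<Rightarrow> nat \<Rightarrow> phasefun. \<forall>N\<ge>1.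
        func_indep N (\<lambda>a x p. \<Sum>i<N. E a (p i)) \<and>
        (\<exists>Q. liouville_with N (H N) Q \<and>
             (\<forall>a\<in>{1..N}. finite_range_with eps N (\<lambda>x p. Q a x p - (\<Sum>i<N. E a (p i))) (W a))))"

section \<open>The model\<close>

text \<open>The map omega : (y, theta) |-> (x, p) on R^{2N}.\<close>
definition omega :: "(real \<Rightarrow> real \<Rightarrow> real) \<Rightarrow> nat \<Rightarrow> (nat \<Rightarrow> real) \<Rightarrow> (nat \<Rightarrow> real)
    \<Rightarrow> (nat \<Rightarrow> real) \<times> (nat \<Rightarrow> real)" where
  "omega psi N y th =
     (let x = (THE x. x \<in> sub N \<and>
                 (\<forall>i<N. y i = x i + (\<Sum>j\<in>{..<N} - {i}. pdt psi (x i - x j) (th i - th j))))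
      in (x, \<lambda>i. if i < N then th i + (\<Sum>j\<in>{..<N} - {i}. pdx psi (x i - x j) (th i - th j))
                 else 0))"

definition omega_inv :: "(real \<Rightarrow> real \<Rightarrow> real) \<Rightarrow> nat \<Rightarrow> (nat \<Rightarrow> real) \<Rightarrow> (nat \<Rightarrow> real)
    \<Rightarrow> (nat \<Rightarrow> real) \<times> (nat \<Rightarrow> real)" where
  "omega_inv psi N x p = the_inv_into (sub N \<times> sub N) (\<lambda>(y, th). omega psi N y th) (x, p)"

text \<open>theta_i(x,p): theta-components of omega^{-1}(x,p).\<close>
definition theta :: "(real \<Rightarrow> real \<Rightarrow> real) \<Rightarrow> nat \<Rightarrow> (nat \<Rightarrow> real) \<Rightarrow> (nat \<Rightarrow> real) \<Rightarrow> nat \<Rightarrow> real" where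
  "theta psi N x p = snd (omega_inv psi N x p)"

definition Hpsi :: "(real \<Rightarrow> real \<Rightarrow> real) \<Rightarrow> nat \<Rightarrow> phasefun" where
  "Hpsi psi N x p = (1/2) * (\<Sum>i<N. (theta psi N x p i)\<^sup>2)"

definition Qpsi :: "(real \<Rightarrow> real \<Rightarrow> real) \<Rightarrow> nat \<Rightarrow> nat \<Rightarrow> phasefun" where
  "Qpsi psi N a x p = (\<Sum>i<N. (theta psi N x p i) ^ a)"

text \<open>gamma solves x_i' = {x_i, H}, p_i' = {p_i, H} on the interval J.\<close>
definition hamilton_solution :: "nat \<Rightarrow> phasefun \<Rightarrow> real set
    \<Rightarrow> (real \<Rightarrow> (nat \<Rightarrow> real) \<times> (nat \<Rightarrow> real)) \<Rightarrow> bool" where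
  "hamilton_solution N H J gamma \<longleftrightarrow>
     (\<forall>t\<in>J. gamma t \<in> sub N \<times> sub N \<and>
        (\<forall>i<N.
          ((\<lambda>s. fst (gamma s) i) has_real_derivative
              pbracket N (\<lambda>x p. x i) H (fst (gamma t)) (snd (gamma t))) (at t within J) \<and>
          ((\<lambda>s. snd (gamma s) i) has_real_derivative
              pbracket N (\<lambda>x p. p i) H (fst (gamma t)) (snd (gamma t))) (at t within J)))"

end

theory Submission
  imports Defs "HOL-Homology.Invariance_of_Domain"
begin

text \<open>
  For fixed \<open>x\<close> the momenta are a function of \<open>th\<close> of the form
  \<open>u i + (\<Sum>j. \<phi> i j (u i - u j))\<close> with nondecreasing \<open>\<phi> i j\<close>, and for fixed \<open>th\<close> so are the \<open>y i\<close> as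
  functions of \<open>x\<close>. By a maximum principle such maps do not decrease sup-norm distances; together with
  invariance of domain they are bijective. In particular \<open>theta psi N x p\<close> is determined by the momentum
  equation alone, without reference to \<open>y\<close>.

  Writing \<open>A = \<partial>p/\<partial>x\<close> and \<open>M = \<partial>p/\<partial>\<theta> = \<partial>y/\<partial>x\<close>, both symmetric because of the reflection symmetry of
  \<open>psi\<close>, a function \<open>\<Sum>i. f (\<theta> i)\<close> has \<open>p\<close>-gradient \<open>u = M\<^sup>-\<^sup>1 f'(\<theta>)\<close> and \<open>x\<close>-gradient \<open>- A u\<close>. Symmetry of \<open>A\<close>
  gives the Poisson commutation; along any Hamiltonian trajectory \<open>\<theta>\<close> is constant and \<open>y' = M x' = \<theta>\<close>, so the
  trajectories are straight lines in \<open>(y, \<theta>)\<close> although the vector field is merely continuous. Since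
  \<open>pdx psi\<close> vanishes beyond distance \<open>eps\<close>, the momentum equation decouples over clusters, and
  uniqueness of its solution gives the finite range.
\<close>

section \<open>Diagonally dominant monotone systems\<close>

lemma tendsto_coordinatewise:
  fixes f :: "'a \<Rightarrow> 'b \<Rightarrow> real"
  assumes "\<And>k. ((\<lambda>s. f s k) \<longlongrightarrow> l k) F"
  shows "(f \<longlongrightarrow> l) F"
proof -
  have "limitin (product_topology (\<lambda>_. euclideanreal) UNIV) f l F"
    using assms by (simp add: limitin_componentwise)
  then show ?thesis
    by (simp add: euclidean_product_topology)
qed

text \<open>Common shape of the momentum equation at fixed \<open>x\<close> and of the position
  equation at fixed \<open>th\<close>. The diagonal term \<open>\<phi> i i 0\<close> cancels in
  differences and vanishes for the odd functions inserted later. Padding with 0 keeps the image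
  inside \<open>sub N\<close>.\<close>

definition pair_map :: "nat \<Rightarrow> (nat \<Rightarrow> nat \<Rightarrow> real \<Rightarrow> real) \<Rightarrow> (nat \<Rightarrow> real) \<Rightarrow> nat \<Rightarrow> real" where
  "pair_map N \<phi> u = (\<lambda>i. if i < N then u i + (\<Sum>j<N. \<phi> i j (u i - u j)) else 0)"

lemma pair_map_in_sub [simp]: "pair_map N \<phi> u \<in> sub N"
  by (simp add: pair_map_def sub_def)

lemma sub_eqI: "u \<in> sub N \<Longrightarrow> w \<in> sub N \<Longrightarrow> (\<And>i. i < N \<Longrightarrow> u i = w i) \<Longrightarrow> u = w"
  by (rule ext) (metis (mono_tags, lifting) mem_Collect_eq not_le sub_def)

text \<open>Maximum principle: at the index \<open>i\<close> where \<open>\<bar>u i - w i\<bar>\<close> is largest, all the increments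
  of the monotone terms have the sign of \<open>u i - w i\<close>.\<close>

lemma pair_map_expanding:
  assumes mono: "\<And>i j. i < N \<Longrightarrow> j < N \<Longrightarrow> mono (\<phi> i j)" and "k < N"
  shows "\<exists>i<N. \<bar>u k - w k\<bar> \<le> \<bar>pair_map N \<phi> u i - pair_map N \<phi> w i\<bar>"
proof -
  have "\<exists>i\<in>{..<N}. \<forall>j\<in>{..<N}. \<not> \<bar>u i - w i\<bar> < \<bar>u j - w j\<bar>"
    using ex_is_arg_min_if_finite[of "{..<N}" "\<lambda>i. - \<bar>u i - w i\<bar>"] \<open>k < N\<close>
    by (auto simp: is_arg_min_def)
  then obtain i where i: "i < N" and max: "\<And>j. j < N \<Longrightarrow> \<bar>u j - w j\<bar> \<le> \<bar>u i - w i\<bar>"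
    by (auto simp: not_less)
  have D: "pair_map N \<phi> u i - pair_map N \<phi> w i
      = u i - w i + (\<Sum>j<N. \<phi> i j (u i - u j) - \<phi> i j (w i - w j))"
    using i by (simp add: pair_map_def sum_subtractf)
  have "\<bar>u i - w i\<bar> \<le> \<bar>pair_map N \<phi> u i - pair_map N \<phi> w i\<bar>"
  proof (cases "u i \<ge> w i")
    case True
    have "0 \<le> (\<Sum>j<N. \<phi> i j (u i - u j) - \<phi> i j (w i - w j))"
    proof (rule sum_nonneg)
      fix j assume "j \<in> {..<N}"
      then have "w i - w j \<le> u i - u j"
        using max[of j] True by auto
      then show "0 \<le> \<phi> i j (u i - u j) - \<phi> i j (w i - w j)"
        using mono[of i j] i \<open>j \<in> {..<N}\<close> by (auto simp: mono_def)
    qed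
    then show ?thesis using D True by linarith
  next
    case False
    have "0 \<ge> (\<Sum>j<N. \<phi> i j (u i - u j) - \<phi> i j (w i - w j))"
    proof (rule sum_nonpos)
      fix j assume "j \<in> {..<N}"
      then have "w i - w j \<ge> u i - u j"
        using max[of j] False by auto
      then show "0 \<ge> \<phi> i j (u i - u j) - \<phi> i j (w i - w j)"
        using mono[of i j] i \<open>j \<in> {..<N}\<close> by (auto simp: mono_def)
    qed
    then show ?thesis using D False by linarith
  qed
  then show ?thesis using i max[OF \<open>k < N\<close>] by (meson order_trans)
qed

lemma pair_map_inject:
  assumes "\<And>i j. i < N \<Longrightarrow> j < N \<Longrightarrow> mono (\<phi> i j)" "u \<in> sub N" "w \<in> sub N"
    and "pair_map N \<phi> u = pair_map N \<phi> w"
  shows "u = w"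
proof (rule sub_eqI[OF assms(2,3)])
  fix k assume "k < N"
  then show "u k = w k"
    using pair_map_expanding[of N \<phi> k u w, OF assms(1)] assms(4) by auto
qed

text \<open>The expansion bound has constant 1 for all monotone systems alike, so it stays uniform
  when the system varies with \<open>s\<close>. Continuity of linear solutions, of
  \<open>theta\<close> and of positions along the flow all come from here.\<close>

lemma pair_map_tendsto_cancel:
  assumes mono: "\<And>i j s. i < N \<Longrightarrow> j < N \<Longrightarrow> mono (\<phi> s i j)"
    and lim: "\<And>i. i < N \<Longrightarrow> ((\<lambda>s. pair_map N (\<phi> s) (u s) i - pair_map N (\<phi> s) (w s) i) \<longlongrightarrow> 0) F"
    and "k < N"
  shows "((\<lambda>s. u s k - w s k) \<longlongrightarrow> 0) F"
proof (rule Lim_null_comparison)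
  show "((\<lambda>s. \<Sum>i<N. \<bar>pair_map N (\<phi> s) (u s) i - pair_map N (\<phi> s) (w s) i\<bar>) \<longlongrightarrow> 0) F"
    using lim by (intro tendsto_null_sum tendsto_rabs_zero) auto
  show "\<forall>\<^sub>F s in F. norm (u s k - w s k)
      \<le> (\<Sum>i<N. \<bar>pair_map N (\<phi> s) (u s) i - pair_map N (\<phi> s) (w s) i\<bar>)"
  proof (rule always_eventually, rule allI)
    fix s
    obtain i where i: "i < N" "\<bar>u s k - w s k\<bar> \<le> \<bar>pair_map N (\<phi> s) (u s) i - pair_map N (\<phi> s) (w s) i\<bar>"
      using pair_map_expanding[of N "\<phi> s" k "u s" "w s", OF mono \<open>k < N\<close>] by blast
    moreover have "\<bar>pair_map N (\<phi> s) (u s) i - pair_map N (\<phi> s) (w s) i\<bar>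
        \<le> (\<Sum>i<N. \<bar>pair_map N (\<phi> s) (u s) i - pair_map N (\<phi> s) (w s) i\<bar>)"
      using i(1) by (intro member_le_sum) auto
    ultimately show "norm (u s k - w s k) \<le> (\<Sum>i<N. \<bar>pair_map N (\<phi> s) (u s) i - pair_map N (\<phi> s) (w s) i\<bar>)"
      by simp
  qed
qed

lemma Euclidean_space_eq_sub: "Euclidean_space N = top_of_set (sub N)"
  by (simp add: Euclidean_space_def sub_def euclidean_product_topology)

text \<open>The image of \<open>sub N\<close> is open by invariance of domain, closed because
  expansion turns convergent images into Cauchy preimages, and nonempty. As \<open>sub N\<close> is
  connected, the image is everything.\<close>

lemma pair_map_surj:
  assumes mono: "\<And>i j. i < N \<Longrightarrow> j < N \<Longrightarrow> mono (\<phi> i j)"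
    and cont: "\<And>i j. i < N \<Longrightarrow> j < N \<Longrightarrow> continuous_on UNIV (\<phi> i j)"
    and v: "v \<in> sub N"
  shows "\<exists>u\<in>sub N. pair_map N \<phi> u = v"
proof -
  have contF: "continuous_on UNIV (pair_map N \<phi>)"
  proof (rule continuous_on_coordinatewise_then_product)
    fix i
    show "continuous_on UNIV (\<lambda>u. pair_map N \<phi> u i)"
    proof (cases "i < N")
      case True
      have "continuous_on UNIV (\<lambda>u. \<phi> i j (u i - u j))" if "j < N" for j
        by (rule continuous_on_compose2[OF cont[OF True that]])
           (auto intro!: continuous_intros continuous_on_product_coordinates)
      then show ?thesis using True unfolding pair_map_def
        by (auto intro!: continuous_intros continuous_on_product_coordinates)
    qed (simp add: pair_map_def)
  qed
  have inj: "inj_on (pair_map N \<phi>) (sub N)"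
    by (rule inj_onI) (rule pair_map_inject[OF mono])
  have "openin (Euclidean_space N) (pair_map N \<phi> ` sub N)"
  proof (rule invariance_of_domain_Euclidean_space[OF _ _ inj])
    show "openin (Euclidean_space N) (sub N)"
      by (simp add: Euclidean_space_eq_sub)
    show "continuous_map (subtopology (Euclidean_space N) (sub N)) (Euclidean_space N) (pair_map N \<phi>)"
      using continuous_on_subset[OF contF, of "sub N"]
      by (simp add: Euclidean_space_eq_sub subtopology_subtopology image_subset_iff)
  qed
  moreover have "closedin (top_of_set (sub N)) (pair_map N \<phi> ` sub N)"
  proof -
    have "closed (pair_map N \<phi> ` sub N)"
      unfolding closed_sequential_limits
    proof (intro allI impI)
      fix X l assume X: "(\<forall>n. X n \<in> pair_map N \<phi> ` sub N) \<and> X \<longlonglongrightarrow> l"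
      then have "\<forall>n. \<exists>u. u \<in> sub N \<and> X n = pair_map N \<phi> u" by auto
      then obtain U where U: "\<And>n. U n \<in> sub N" "\<And>n. X n = pair_map N \<phi> (U n)"
        using choice[of "\<lambda>n u. u \<in> sub N \<and> X n = pair_map N \<phi> u"] by auto
      have Xk: "(\<lambda>n. X n k) \<longlonglongrightarrow> l k" for k
        by (rule continuous_on_tendsto_compose[OF continuous_on_product_coordinates[of k]])
           (use X in auto)
      \<comment> \<open>Each coordinate of \<open>U m - U n\<close> is bounded by some coordinate of
        \<open>X m - X n\<close>, and there are only finitely many of these.\<close>
      have "Cauchy (\<lambda>n. U n k)" if "k < N" for k
      proof (rule metric_CauchyI)
        fix e :: real assume e: "e > 0"
        have "\<forall>\<^sub>F M in sequentially. \<forall>i\<in>{..<N}. dist (X M i) (l i) < e/2"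
          using eventually_ball_finite[of "{..<N}" "\<lambda>M i. dist (X M i) (l i) < e/2" sequentially]
            tendstoD[OF Xk, of "e/2"] e by auto
        then obtain M where M: "\<And>m i. m \<ge> M \<Longrightarrow> i < N \<Longrightarrow> dist (X m i) (l i) < e/2"
          by (auto simp: eventually_sequentially)
        have "dist (U m k) (U n k) < e" if "m \<ge> M" "n \<ge> M" for m n
        proof -
          obtain i where i: "i < N" "\<bar>U m k - U n k\<bar> \<le> \<bar>X m i - X n i\<bar>"
            using pair_map_expanding[of N \<phi> k "U m" "U n", OF mono \<open>k < N\<close>] U by auto
          have "dist (X m i) (X n i) < e"
            using dist_triangle_half_l[OF M[OF that(1) i(1)] M[OF that(2) i(1)]] .
          then show ?thesis using i by (simp add: dist_real_def)
        qed
        then show "\<exists>M. \<forall>m\<ge>M. \<forall>n\<ge>M. dist (U m k) (U n k) < e" by blast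
      qed
      then have "\<exists>c. (\<lambda>n. U n k) \<longlonglongrightarrow> c" if "k < N" for k
        using that by (simp add: Cauchy_convergent_iff convergent_def)
      then obtain c where c: "\<And>k. k < N \<Longrightarrow> (\<lambda>n. U n k) \<longlonglongrightarrow> c k" by metis
      define u where "u = (\<lambda>k. if k < N then c k else 0)"
      have "(\<lambda>n. U n k) \<longlonglongrightarrow> u k" for k
        using c[of k] U(1) by (auto simp: u_def sub_def)
      then have "U \<longlonglongrightarrow> u" by (rule tendsto_coordinatewise)
      then have "(\<lambda>n. pair_map N \<phi> (U n)) \<longlonglongrightarrow> pair_map N \<phi> u"
        by (rule continuous_on_tendsto_compose[OF contF]) simp_all
      then have "(\<lambda>n. X n) \<longlonglongrightarrow> pair_map N \<phi> u"
        unfolding U(2) .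
      then have "l = pair_map N \<phi> u"
        using conjunct2[OF X] LIMSEQ_unique by blast
      moreover have "u \<in> sub N" by (simp add: u_def sub_def)
      ultimately show "l \<in> pair_map N \<phi> ` sub N" by (rule image_eqI)
    qed
    then show ?thesis
      by (intro closed_subset) auto
  qed
  moreover have "connected (sub N)"
    using connected_Euclidean_space[of N]
    by (simp add: Euclidean_space_eq_sub connectedin_def flip: connectedin_iff_connected)
  moreover have "(\<lambda>_. 0) \<in> sub N" by (simp add: sub_def)
  ultimately have "pair_map N \<phi> ` sub N = sub N"
    unfolding Euclidean_space_eq_sub connected_clopen by blast
  then have "v \<in> pair_map N \<phi> ` sub N" using v by simp
  then show ?thesis by auto
qed

subsection \<open>The linear case\<close>

text \<open>Weighted graph Laplacian. The Jacobians needed below have this form, possibly plus the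
  identity, because the interaction depends on differences only. Diagonal weights drop out.\<close>

definition lap :: "nat \<Rightarrow> (nat \<Rightarrow> nat \<Rightarrow> real) \<Rightarrow> (nat \<Rightarrow> real) \<Rightarrow> nat \<Rightarrow> real" where
  "lap N B u i = (\<Sum>j<N. B i j * (u i - u j))"

definition nonneg :: "nat \<Rightarrow> (nat \<Rightarrow> nat \<Rightarrow> real) \<Rightarrow> bool" where
  "nonneg N B \<longleftrightarrow> (\<forall>i<N. \<forall>j<N. 0 \<le> B i j)"

definition symm :: "nat \<Rightarrow> (nat \<Rightarrow> nat \<Rightarrow> real) \<Rightarrow> bool" where
  "symm N B \<longleftrightarrow> (\<forall>i<N. \<forall>j<N. B i j = B j i)"

text \<open>The inverse of identity plus \<open>lap N B\<close>, applied to \<open>v\<close>; the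
  condition \<open>u \<in> sub N\<close> fixes the values at indices that the equations do not
  reach.\<close>

definition lsolve :: "nat \<Rightarrow> (nat \<Rightarrow> nat \<Rightarrow> real) \<Rightarrow> (nat \<Rightarrow> real) \<Rightarrow> nat \<Rightarrow> real" where
  "lsolve N B v = (THE u. u \<in> sub N \<and> (\<forall>i<N. u i + lap N B u i = v i))"

definition unitv :: "nat \<Rightarrow> nat \<Rightarrow> real" where
  "unitv k i = (if i = k then 1 else 0)"

lemma mono_linear: "nonneg N B \<Longrightarrow> i < N \<Longrightarrow> j < N \<Longrightarrow> mono (\<lambda>s. B i j * s)"
  by (auto simp: nonneg_def mono_def intro: mult_left_mono)

lemma pair_map_linear: "i < N \<Longrightarrow> pair_map N (\<lambda>i j s. B i j * s) u i = u i + lap N B u i"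
  by (simp add: pair_map_def lap_def)

text \<open>Nonnegative weights make the system a \<open>pair_map\<close> with monotone linear
  functions, so the nonlinear theory already gives existence and uniqueness.\<close>

lemma lsolve_ex1:
  assumes "nonneg N B"
  shows "\<exists>!u. u \<in> sub N \<and> (\<forall>i<N. u i + lap N B u i = v i)"
proof -
  let ?F = "pair_map N (\<lambda>i j s. B i j * s)"
  have eq: "(\<forall>i<N. u i + lap N B u i = v i) \<longleftrightarrow> ?F u = (\<lambda>i. if i < N then v i else 0)" for u
    by (auto simp: fun_eq_iff pair_map_def lap_def)
  have "\<exists>u\<in>sub N. ?F u = (\<lambda>i. if i < N then v i else 0)"
    by (rule pair_map_surj) (use mono_linear[OF assms] in \<open>auto simp: sub_def intro!: continuous_intros\<close>)
  moreover have "u = w" if "u \<in> sub N" "w \<in> sub N" "?F u = ?F w" for u w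
    by (rule pair_map_inject[OF _ that]) (rule mono_linear[OF assms])
  ultimately show ?thesis unfolding eq by (intro ex_ex1I) auto
qed

lemma lsolve_eq:
  assumes "nonneg N B" "i < N"
  shows "lsolve N B v i + lap N B (lsolve N B v) i = v i"
  using theI'[OF lsolve_ex1[OF assms(1), of v]] assms(2) unfolding lsolve_def by blast

lemma lap_cong: "(\<And>i. i < N \<Longrightarrow> u i = w i) \<Longrightarrow> i < N \<Longrightarrow> lap N B u i = lap N B w i"
  by (simp add: lap_def)

lemma lsolve_unique:
  assumes "nonneg N B" and eq: "\<And>i. i < N \<Longrightarrow> u i + lap N B u i = v i" and "i < N"
  shows "u i = lsolve N B v i"
proof -
  \<comment> \<open>\<open>u\<close> may be nonzero from index \<open>N\<close> on; truncation
    brings it into \<open>sub N\<close> without affecting the equations.\<close>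
  define w where "w = (\<lambda>i. if i < N then u i else 0)"
  have "w i + lap N B w i = v i" if "i < N" for i
    using eq[OF that] lap_cong[of N w u i B] that by (simp add: w_def)
  moreover have "w \<in> sub N" by (simp add: w_def sub_def)
  ultimately have "lsolve N B v = w"
    unfolding lsolve_def using lsolve_ex1[OF assms(1), of v] by (intro the1_equality) auto
  then show ?thesis using \<open>i < N\<close> by (simp add: w_def)
qed

lemma lap_sum: "lap N B (\<lambda>l. \<Sum>k\<in>K. c k * u k l) i = (\<Sum>k\<in>K. c k * lap N B (u k) i)"
proof -
  have "lap N B (\<lambda>l. \<Sum>k\<in>K. c k * u k l) i = (\<Sum>j<N. \<Sum>k\<in>K. c k * (B i j * (u k i - u k j)))"
    unfolding lap_def by (intro sum.cong refl)
      (simp add: sum_distrib_left sum_subtractf right_diff_distrib mult.left_commute)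
  also have "\<dots> = (\<Sum>k\<in>K. c k * lap N B (u k) i)"
    unfolding lap_def by (subst sum.swap) (simp add: sum_distrib_left)
  finally show ?thesis .
qed

lemma lap_diff: "lap N B (\<lambda>l. u l - w l) i = lap N B u i - lap N B w i"
  unfolding lap_def sum_subtractf[symmetric] by (intro sum.cong refl) (simp add: algebra_simps)

lemma lap_scale: "lap N B (\<lambda>l. c * u l) i = c * lap N B u i"
  by (simp add: lap_def sum_distrib_left algebra_simps)

lemma unitv_expand: "l < N \<Longrightarrow> (\<Sum>k<N. u k * unitv k l) = u l"
  by (simp add: unitv_def if_distrib[of "(*) _"] cong: if_cong)

lemma unitv_expand2: "l < N \<Longrightarrow> (\<Sum>k<N. u k * unitv l k) = u l"
  by (simp add: unitv_def if_distrib[of "(*) _"] cong: if_cong)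

lemma lap_expand: "i < N \<Longrightarrow> lap N B u i = (\<Sum>k<N. u k * lap N B (unitv k) i)"
  by (subst lap_sum[symmetric]) (auto intro: lap_cong simp: unitv_expand)

lemma lsolve_sum:
  assumes "nonneg N B" "i < N"
  shows "lsolve N B (\<lambda>l. \<Sum>k\<in>K. c k * v k l) i = (\<Sum>k\<in>K. c k * lsolve N B (v k) i)"
  by (rule lsolve_unique[OF assms(1) _ assms(2), symmetric])
     (simp add: lap_sum sum.distrib[symmetric] distrib_left[symmetric] lsolve_eq[OF assms(1)])

lemma lsolve_diff:
  assumes "nonneg N B" "i < N"
  shows "lsolve N B (\<lambda>l. u l - w l) i = lsolve N B u i - lsolve N B w i"
proof (rule lsolve_unique[OF assms(1) _ assms(2), symmetric])
  fix i assume i: "i < N"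
  show "lsolve N B u i - lsolve N B w i + lap N B (\<lambda>l. lsolve N B u l - lsolve N B w l) i = u i - w i"
    using lsolve_eq[OF assms(1) i, of u] lsolve_eq[OF assms(1) i, of w] by (simp add: lap_diff)
qed

lemma lsolve_cong:
  assumes "\<And>i. i < N \<Longrightarrow> v i = w i"
  shows "lsolve N B v = lsolve N B w"
proof -
  have "(\<forall>i<N. u i + lap N B u i = v i) \<longleftrightarrow> (\<forall>i<N. u i + lap N B u i = w i)" for u
    using assms by auto
  then show ?thesis by (simp add: lsolve_def)
qed

text \<open>Self-adjointness for symmetric weights: the diagonal contributions cancel, and the cross
  terms agree after the two summation indices are exchanged.\<close>

lemma lap_symm:
  assumes "symm N B"
  shows "(\<Sum>i<N. w i * lap N B u i) = (\<Sum>i<N. lap N B w i * u i)"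
proof -
  have "(\<Sum>i<N. w i * lap N B u i) - (\<Sum>i<N. lap N B w i * u i)
     = (\<Sum>i<N. \<Sum>j<N. B i j * (w j * u i)) - (\<Sum>i<N. \<Sum>j<N. B i j * (w i * u j))"
    unfolding lap_def sum_distrib_left sum_distrib_right sum_subtractf[symmetric]
    by (intro sum.cong refl) (simp add: algebra_simps)
  also have "(\<Sum>i<N. \<Sum>j<N. B i j * (w j * u i)) = (\<Sum>j<N. \<Sum>i<N. B i j * (w j * u i))"
    by (rule sum.swap)
  also have "\<dots> = (\<Sum>i<N. \<Sum>j<N. B i j * (w i * u j))"
    using assms by (intro sum.cong refl) (auto simp: symm_def)
  finally show ?thesis by simp
qed

text \<open>The inverse of a self-adjoint map is self-adjoint: express \<open>w\<close> through its
  own solution and move the Laplacian to the other factor.\<close>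

lemma lsolve_symm:
  assumes "symm N B" "nonneg N B"
  shows "(\<Sum>i<N. w i * lsolve N B u i) = (\<Sum>i<N. lsolve N B w i * u i)"
proof -
  let ?U = "lsolve N B u" and ?W = "lsolve N B w"
  have "(\<Sum>i<N. w i * ?U i) = (\<Sum>i<N. (?W i + lap N B ?W i) * ?U i)"
    using lsolve_eq[OF assms(2)] by (intro sum.cong) auto
  also have "\<dots> = (\<Sum>i<N. ?W i * ?U i) + (\<Sum>i<N. ?W i * lap N B ?U i)"
    by (subst lap_symm[OF assms(1)]) (simp add: sum.distrib algebra_simps)
  also have "\<dots> = (\<Sum>i<N. ?W i * (?U i + lap N B ?U i))"
    by (simp add: sum.distrib algebra_simps)
  also have "\<dots> = (\<Sum>i<N. ?W i * u i)"
    using lsolve_eq[OF assms(2)] by (intro sum.cong) auto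
  finally show ?thesis .
qed

text \<open>Continuity of the inverse in the matrix and the right side. The fixed limit solution is
  inserted into the varying system; its residual tends to 0, and expansion bounds the distance of
  the solutions by the residual.\<close>

lemma lsolve_tendsto:
  assumes nn: "\<And>s. nonneg N (B s)"
    and B: "\<And>i j. i < N \<Longrightarrow> j < N \<Longrightarrow> ((\<lambda>s. B s i j) \<longlongrightarrow> B0 i j) F" and nn0: "nonneg N B0"
    and v: "\<And>i. i < N \<Longrightarrow> ((\<lambda>s. v s i) \<longlongrightarrow> v0 i) F" and "k < N"
  shows "((\<lambda>s. lsolve N (B s) (v s) k) \<longlongrightarrow> lsolve N B0 v0 k) F"
proof -
  let ?u0 = "lsolve N B0 v0"
  have "((\<lambda>s. lsolve N (B s) (v s) k - ?u0 k) \<longlongrightarrow> 0) F"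
  proof (rule pair_map_tendsto_cancel[where \<phi> = "\<lambda>s i j r. B s i j * r" and w = "\<lambda>_. ?u0"])
    fix i assume i: "i < N"
    have "((\<lambda>s. v s i - (?u0 i + lap N (B s) ?u0 i)) \<longlongrightarrow> v0 i - (?u0 i + lap N B0 ?u0 i)) F"
      unfolding lap_def using B v i by (intro tendsto_intros) auto
    then show "((\<lambda>s. pair_map N (\<lambda>i j r. B s i j * r) (lsolve N (B s) (v s)) i
        - pair_map N (\<lambda>i j r. B s i j * r) ?u0 i) \<longlongrightarrow> 0) F"
      using i lsolve_eq[OF nn] lsolve_eq[OF nn0] by (simp add: pair_map_linear)
  qed (use mono_linear[OF nn] \<open>k < N\<close> in auto)
  then show ?thesis by (simp add: LIM_zero_iff)
qed

section \<open>Calculus on phase space\<close>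

text \<open>Unlike \<open>at _ within _\<close>, this filter keeps the point itself, so limits
  compose even when the inner function attains its limit.\<close>

abbreviation near :: "nat \<Rightarrow> (nat \<Rightarrow> real) \<Rightarrow> (nat \<Rightarrow> real) \<Rightarrow> ((nat \<Rightarrow> real) \<times> (nat \<Rightarrow> real)) filter" where
  "near n x p \<equiv> inf (nhds (x, p)) (principal (sub n \<times> sub n))"

text \<open>Caratheodory's form of the Frechet derivative: increments are linear combinations of the
  coordinate increments, with coefficients that tend to the gradient.\<close>

definition cdiff :: "nat \<Rightarrow> phasefun \<Rightarrow> (nat \<Rightarrow> real) \<Rightarrow> (nat \<Rightarrow> real)
    \<Rightarrow> (nat \<Rightarrow> real) \<Rightarrow> (nat \<Rightarrow> real) \<Rightarrow> bool" where
  "cdiff n F x p gx gp \<longleftrightarrow> (\<exists>CX CP :: (nat \<Rightarrow> real) \<times> (nat \<Rightarrow> real) \<Rightarrow> nat \<Rightarrow> real.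
     (\<forall>z\<in>sub n \<times> sub n. F (fst z) (snd z) - F x p
        = (\<Sum>k<n. CX z k * (fst z k - x k) + CP z k * (snd z k - p k))) \<and>
     (\<forall>k<n. ((\<lambda>z. CX z k) \<longlongrightarrow> gx k) (near n x p) \<and> ((\<lambda>z. CP z k) \<longlongrightarrow> gp k) (near n x p)))"

lemma continuous_on_UNIV_tendsto_nhds:
  assumes "continuous_on UNIV f"
  shows "(f \<longlongrightarrow> f z) (nhds z)"
proof -
  have "(f \<longlongrightarrow> f z) (at z)" using assms by (auto simp: continuous_on_def)
  then show ?thesis by (rule tendsto_at_iff_tendsto_nhds[THEN iffD1])
qed

lemma at_within_le_near: "at z within sub n \<times> sub n \<le> near n (fst z) (snd z)"
  unfolding at_within_def prod.collapse by (rule inf_mono[OF order_refl]) auto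

lemma tendsto_fst_near: "((\<lambda>z. fst z k) \<longlongrightarrow> x k) (near n x p)"
proof -
  have "continuous_on UNIV (\<lambda>z :: (nat \<Rightarrow> real) \<times> (nat \<Rightarrow> real). fst z k)"
    by (rule continuous_on_product_then_coordinatewise) (intro continuous_on_fst continuous_on_id)
  from continuous_on_UNIV_tendsto_nhds[OF this, of "(x, p)"]
  have "((\<lambda>z. fst z k) \<longlongrightarrow> x k) (nhds (x, p))" by simp
  then show ?thesis by (rule filterlim_mono[OF _ order_refl inf_le1])
qed

lemma tendsto_snd_near: "((\<lambda>z. snd z k) \<longlongrightarrow> p k) (near n x p)"
proof -
  have "continuous_on UNIV (\<lambda>z :: (nat \<Rightarrow> real) \<times> (nat \<Rightarrow> real). snd z k)"
    by (rule continuous_on_product_then_coordinatewise) (intro continuous_on_snd continuous_on_id)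
  from continuous_on_UNIV_tendsto_nhds[OF this, of "(x, p)"]
  have "((\<lambda>z. snd z k) \<longlongrightarrow> p k) (nhds (x, p))" by simp
  then show ?thesis by (rule filterlim_mono[OF _ order_refl inf_le1])
qed

lemma eventually_near_sub: "\<forall>\<^sub>F z in near n x p. z \<in> sub n \<times> sub n"
  by (simp add: eventually_inf_principal)

lemma filterlim_near:
  assumes "\<And>k. ((\<lambda>s. u s k) \<longlongrightarrow> x k) F" "\<And>k. ((\<lambda>s. w s k) \<longlongrightarrow> p k) F"
    and "\<forall>\<^sub>F s in F. u s \<in> sub n \<and> w s \<in> sub n"
  shows "filterlim (\<lambda>s. (u s, w s)) (near n x p) F"
  unfolding filterlim_inf filterlim_principal
proof
  have "(u \<longlongrightarrow> x) F" "(w \<longlongrightarrow> p) F"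
    using assms by (auto intro: tendsto_coordinatewise)
  then show "((\<lambda>s. (u s, w s)) \<longlongrightarrow> (x, p)) F" by (rule tendsto_Pair)
  show "\<forall>\<^sub>F s in F. (u s, w s) \<in> sub n \<times> sub n" using assms(3) by simp
qed

lemma sub_upd: "x \<in> sub n \<Longrightarrow> k < n \<Longrightarrow> x(k := s) \<in> sub n"
  by (simp add: sub_def)

lemma sub_add: "x \<in> sub n \<Longrightarrow> h \<in> sub n \<Longrightarrow> (\<lambda>k. x k + h k) \<in> sub n"
  by (simp add: sub_def)

lemma cdiff_cong:
  assumes "cdiff n F x p gx gp" "\<And>k. k < n \<Longrightarrow> gx k = hx k" "\<And>k. k < n \<Longrightarrow> gp k = hp k"
  shows "cdiff n F x p hx hp"
  using assms unfolding cdiff_def by simp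

lemma cdiff_cong_fun:
  assumes "cdiff n F x p gx gp" "x \<in> sub n" "p \<in> sub n"
    and "\<And>x p. x \<in> sub n \<Longrightarrow> p \<in> sub n \<Longrightarrow> F x p = G x p"
  shows "cdiff n G x p gx gp"
proof -
  have "F (fst z) (snd z) = G (fst z) (snd z)" if "z \<in> sub n \<times> sub n" for z
    using that assms(4) by auto
  then show ?thesis using assms(1) unfolding cdiff_def assms(4)[OF assms(2,3)] by simp
qed

lemma cdiff_continuous:
  assumes "cdiff n F x p gx gp"
  shows "((\<lambda>z. F (fst z) (snd z)) \<longlongrightarrow> F x p) (near n x p)"
proof -
  obtain CX CP where C: "\<And>z. z \<in> sub n \<times> sub n \<Longrightarrow> F (fst z) (snd z) - F x p
        = (\<Sum>k<n. CX z k * (fst z k - x k) + CP z k * (snd z k - p k))"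
    and lim: "\<And>k. k < n \<Longrightarrow> ((\<lambda>z. CX z k) \<longlongrightarrow> gx k) (near n x p)"
      "\<And>k. k < n \<Longrightarrow> ((\<lambda>z. CP z k) \<longlongrightarrow> gp k) (near n x p)"
    using assms unfolding cdiff_def by blast
  have "((\<lambda>z. F x p + (\<Sum>k<n. CX z k * (fst z k - x k) + CP z k * (snd z k - p k)))
     \<longlongrightarrow> F x p + (\<Sum>k<n. gx k * (x k - x k) + gp k * (p k - p k))) (near n x p)"
    by (intro tendsto_intros lim tendsto_fst_near tendsto_snd_near) auto
  then have "((\<lambda>z. F x p + (\<Sum>k<n. CX z k * (fst z k - x k) + CP z k * (snd z k - p k)))
     \<longlongrightarrow> F x p) (near n x p)"
    by simp
  then show ?thesis
  proof (rule Lim_transform_eventually)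
    show "\<forall>\<^sub>F z in near n x p. F x p + (\<Sum>k<n. CX z k * (fst z k - x k) + CP z k * (snd z k - p k))
        = F (fst z) (snd z)"
      using eventually_near_sub by eventually_elim (use C in force)
  qed
qed

text \<open>The remainder is a combination of coordinate increments with coefficients tending to 0,
  and each increment is at most the Euclidean norm.\<close>

lemma cdiff_imp_has_grad:
  assumes "cdiff n F x p gx gp" "x \<in> sub n" "p \<in> sub n"
  shows "has_grad n F x p gx gp"
proof -
  obtain CX CP where C: "\<And>z. z \<in> sub n \<times> sub n \<Longrightarrow> F (fst z) (snd z) - F x p
        = (\<Sum>k<n. CX z k * (fst z k - x k) + CP z k * (snd z k - p k))"
    and lim: "\<And>k. k < n \<Longrightarrow> ((\<lambda>z. CX z k) \<longlongrightarrow> gx k) (near n x p)"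
      "\<And>k. k < n \<Longrightarrow> ((\<lambda>z. CP z k) \<longlongrightarrow> gp k) (near n x p)"
    using assms(1) unfolding cdiff_def by blast
  let ?G = "at (\<lambda>_. 0, \<lambda>_. 0) within sub n \<times> sub n :: ((nat \<Rightarrow> real) \<times> (nat \<Rightarrow> real)) filter"
  define T :: "(nat \<Rightarrow> real) \<times> (nat \<Rightarrow> real) \<Rightarrow> (nat \<Rightarrow> real) \<times> (nat \<Rightarrow> real)"
    where "T = (\<lambda>v. (\<lambda>k. x k + fst v k, \<lambda>k. p k + snd v k))"
  have le: "?G \<le> near n (\<lambda>_. 0) (\<lambda>_. 0)"
    using at_within_le_near[of "(\<lambda>_. 0, \<lambda>_. 0)" n] by simp
  have evG: "\<forall>\<^sub>F v in ?G. v \<in> sub n \<times> sub n"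
    by (simp add: eventually_at_filter)
  have T: "filterlim T (near n x p) ?G"
    unfolding T_def
  proof (rule filterlim_near)
    show "((\<lambda>v. x k + fst v k) \<longlongrightarrow> x k) ?G" for k
      using tendsto_add[OF tendsto_const filterlim_mono[OF tendsto_fst_near order_refl le], of "x k" k]
      by simp
    show "((\<lambda>v. p k + snd v k) \<longlongrightarrow> p k) ?G" for k
      using tendsto_add[OF tendsto_const filterlim_mono[OF tendsto_snd_near order_refl le], of "p k" k]
      by simp
    show "\<forall>\<^sub>F v in ?G. (\<lambda>k. x k + fst v k) \<in> sub n \<and> (\<lambda>k. p k + snd v k) \<in> sub n"
      using evG by eventually_elim (use assms in \<open>auto intro: sub_add\<close>)
  qed
  have bound: "\<bar>h k\<bar> \<le> enorm2 n h q \<and> \<bar>q k\<bar> \<le> enorm2 n h q" if "k < n" for h q k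
  proof -
    have "(h k)\<^sup>2 + (q k)\<^sup>2 \<le> (\<Sum>k<n. (h k)\<^sup>2 + (q k)\<^sup>2)"
      using that by (intro member_le_sum) auto
    then show ?thesis unfolding enorm2_def
      by (auto intro!: real_le_rsqrt simp: power2_abs) (smt (verit) zero_le_power2)+
  qed
  have lim0: "((\<lambda>v. \<Sum>k<n. \<bar>CX (T v) k - gx k\<bar> + \<bar>CP (T v) k - gp k\<bar>) \<longlongrightarrow> 0) ?G"
    by (intro tendsto_null_sum tendsto_add_zero tendsto_rabs_zero LIM_zero
        filterlim_compose[OF lim(1) T] filterlim_compose[OF lim(2) T]) auto
  have "((\<lambda>v. (F (\<lambda>k. x k + fst v k) (\<lambda>k. p k + snd v k) - F x p
            - (\<Sum>k<n. gx k * fst v k + gp k * snd v k)) / enorm2 n (fst v) (snd v)) \<longlongrightarrow> 0) ?G"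
  proof (rule Lim_null_comparison[OF _ lim0])
    show "\<forall>\<^sub>F v in ?G. norm ((F (\<lambda>k. x k + fst v k) (\<lambda>k. p k + snd v k) - F x p
            - (\<Sum>k<n. gx k * fst v k + gp k * snd v k)) / enorm2 n (fst v) (snd v))
          \<le> (\<Sum>k<n. \<bar>CX (T v) k - gx k\<bar> + \<bar>CP (T v) k - gp k\<bar>)"
      using evG
    proof eventually_elim
      case (elim v)
      then have "T v \<in> sub n \<times> sub n"
        using assms by (auto simp: T_def intro: sub_add)
      let ?e = "enorm2 n (fst v) (snd v)"
      have e0: "0 \<le> ?e" by (simp add: enorm2_def sum_nonneg)
      have "F (\<lambda>k. x k + fst v k) (\<lambda>k. p k + snd v k) - F x p - (\<Sum>k<n. gx k * fst v k + gp k * snd v k)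
        = (\<Sum>k<n. (CX (T v) k - gx k) * fst v k + (CP (T v) k - gp k) * snd v k)"
        using C[OF \<open>T v \<in> sub n \<times> sub n\<close>]
        by (simp add: T_def sum_subtractf[symmetric]) (simp add: algebra_simps)
      also have "\<bar>\<dots>\<bar> \<le> (\<Sum>k<n. (\<bar>CX (T v) k - gx k\<bar> + \<bar>CP (T v) k - gp k\<bar>) * ?e)"
      proof (rule order_trans[OF sum_abs sum_mono])
        fix k assume "k \<in> {..<n}"
        then have "\<bar>CX (T v) k - gx k\<bar> * \<bar>fst v k\<bar> \<le> \<bar>CX (T v) k - gx k\<bar> * ?e"
          "\<bar>CP (T v) k - gp k\<bar> * \<bar>snd v k\<bar> \<le> \<bar>CP (T v) k - gp k\<bar> * ?e"
          using bound[of k] by (auto intro!: mult_left_mono)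
        then show "\<bar>(CX (T v) k - gx k) * fst v k + (CP (T v) k - gp k) * snd v k\<bar>
            \<le> (\<bar>CX (T v) k - gx k\<bar> + \<bar>CP (T v) k - gp k\<bar>) * ?e"
          by (intro order_trans[OF abs_triangle_ineq]) (simp add: abs_mult distrib_right)
      qed
      also have "\<dots> = (\<Sum>k<n. \<bar>CX (T v) k - gx k\<bar> + \<bar>CP (T v) k - gp k\<bar>) * ?e"
        by (simp add: sum_distrib_right)
      \<comment> \<open>For \<open>?e = 0\<close> the quotient is 0 by the convention for division,
        and the bound is a sum of nonnegative terms.\<close>
      finally show ?case using e0
        by (cases "?e = 0") (auto simp: divide_le_eq sum_nonneg)
    qed
  qed
  then show ?thesis by (simp add: has_grad_def case_prod_unfold)
qed

lemma C1_I:
  assumes "\<And>x p. x \<in> sub n \<Longrightarrow> p \<in> sub n \<Longrightarrow> cdiff n F x p (gx x p) (gp x p)"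
    and "\<And>x p k. x \<in> sub n \<Longrightarrow> p \<in> sub n \<Longrightarrow> k < n \<Longrightarrow>
           ((\<lambda>z. gx (fst z) (snd z) k) \<longlongrightarrow> gx x p k) (near n x p)"
    and "\<And>x p k. x \<in> sub n \<Longrightarrow> p \<in> sub n \<Longrightarrow> k < n \<Longrightarrow>
           ((\<lambda>z. gp (fst z) (snd z) k) \<longlongrightarrow> gp x p k) (near n x p)"
  shows "C1 n F"
proof -
  have "continuous_on (sub n \<times> sub n) (\<lambda>(x, p). gx x p k)" if "k < n" for k
    unfolding continuous_on_def
  proof
    fix z assume "z \<in> sub n \<times> sub n"
    then show "((\<lambda>(x, p). gx x p k) \<longlongrightarrow> (case z of (x, p) \<Rightarrow> gx x p k)) (at z within sub n \<times> sub n)"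
      using filterlim_mono[OF assms(2)[of "fst z" "snd z" k] order_refl at_within_le_near] that
      by (auto simp: case_prod_unfold)
  qed
  moreover have "continuous_on (sub n \<times> sub n) (\<lambda>(x, p). gp x p k)" if "k < n" for k
    unfolding continuous_on_def
  proof
    fix z assume "z \<in> sub n \<times> sub n"
    then show "((\<lambda>(x, p). gp x p k) \<longlongrightarrow> (case z of (x, p) \<Rightarrow> gp x p k)) (at z within sub n \<times> sub n)"
      using filterlim_mono[OF assms(3)[of "fst z" "snd z" k] order_refl at_within_le_near] that
      by (auto simp: case_prod_unfold)
  qed
  ultimately show ?thesis
    unfolding C1_def using cdiff_imp_has_grad[OF assms(1)] by blast
qed

text \<open>Chain rule along a curve: divide the Caratheodory identity by \<open>s - t\<close> and
  let \<open>s\<close> tend to \<open>t\<close> inside \<open>J\<close>. The coefficients converge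
  because the curve is continuous at \<open>t\<close>.\<close>

lemma cdiff_curve:
  assumes "cdiff n F (u t) (w t) gx gp"
    and "\<And>k. k < n \<Longrightarrow> ((\<lambda>s. u s k) has_real_derivative du k) (at t within J)"
    and "\<And>k. k < n \<Longrightarrow> ((\<lambda>s. w s k) has_real_derivative dw k) (at t within J)"
    and sub: "\<And>s. s \<in> J \<Longrightarrow> u s \<in> sub n \<and> w s \<in> sub n" and "t \<in> J"
  shows "((\<lambda>s. F (u s) (w s)) has_real_derivative (\<Sum>k<n. gx k * du k + gp k * dw k)) (at t within J)"
proof -
  obtain CX CP where C: "\<And>z. z \<in> sub n \<times> sub n \<Longrightarrow> F (fst z) (snd z) - F (u t) (w t)
        = (\<Sum>k<n. CX z k * (fst z k - u t k) + CP z k * (snd z k - w t k))"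
    and lim: "\<And>k. k < n \<Longrightarrow> ((\<lambda>z. CX z k) \<longlongrightarrow> gx k) (near n (u t) (w t))"
      "\<And>k. k < n \<Longrightarrow> ((\<lambda>z. CP z k) \<longlongrightarrow> gp k) (near n (u t) (w t))"
    using assms(1) unfolding cdiff_def by blast
  have ev: "\<forall>\<^sub>F s in at t within J. s \<in> J \<and> s \<noteq> t"
    by (simp add: eventually_at_filter)
  have T: "filterlim (\<lambda>s. (u s, w s)) (near n (u t) (w t)) (at t within J)"
  proof (rule filterlim_near)
    fix k
    show "((\<lambda>s. u s k) \<longlongrightarrow> u t k) (at t within J)"
    proof (cases "k < n")
      case True
      then show ?thesis using DERIV_continuous[OF assms(2)] by (simp add: continuous_within)
    next
      \<comment> \<open>Coordinates outside the phase space vanish throughout \<open>J\<close>,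
        hence are constant there.\<close>
      case False
      have "\<forall>\<^sub>F s in at t within J. u t k = u s k"
        using ev by eventually_elim (use sub \<open>t \<in> J\<close> False in \<open>auto simp: sub_def\<close>)
      then show ?thesis by (rule Lim_transform_eventually[OF tendsto_const])
    qed
    show "((\<lambda>s. w s k) \<longlongrightarrow> w t k) (at t within J)"
    proof (cases "k < n")
      case True
      then show ?thesis using DERIV_continuous[OF assms(3)] by (simp add: continuous_within)
    next
      case False
      have "\<forall>\<^sub>F s in at t within J. w t k = w s k"
        using ev by eventually_elim (use sub \<open>t \<in> J\<close> False in \<open>auto simp: sub_def\<close>)
      then show ?thesis by (rule Lim_transform_eventually[OF tendsto_const])
    qed
    show "\<forall>\<^sub>F s in at t within J. u s \<in> sub n \<and> w s \<in> sub n"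
      using ev by eventually_elim (use sub in auto)
  qed
  have "((\<lambda>s. \<Sum>k<n. CX (u s, w s) k * ((u s k - u t k) / (s - t)) + CP (u s, w s) k * ((w s k - w t k) / (s - t)))
     \<longlongrightarrow> (\<Sum>k<n. gx k * du k + gp k * dw k)) (at t within J)"
    by (intro tendsto_intros filterlim_compose[OF lim(1) T] filterlim_compose[OF lim(2) T]
        assms(2,3)[unfolded has_field_derivative_iff]) auto
  then show ?thesis unfolding has_field_derivative_iff
  proof (rule Lim_transform_eventually)
    show "\<forall>\<^sub>F s in at t within J. (\<Sum>k<n. CX (u s, w s) k * ((u s k - u t k) / (s - t))
          + CP (u s, w s) k * ((w s k - w t k) / (s - t))) = (F (u s) (w s) - F (u t) (w t)) / (s - t)"
      using ev
    proof eventually_elim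
      case (elim s)
      then show ?case using C[of "(u s, w s)"] sub
        by (simp add: sum_divide_distrib add_divide_distrib)
    qed
  qed
qed

text \<open>The chain rule on a coordinate line, whose velocity is a unit vector. It ties the
  gradients to the \<open>deriv\<close>-based partials that enter the bracket.\<close>

lemma cdiff_pdX:
  assumes "cdiff n F x p gx gp" "x \<in> sub n" "p \<in> sub n" "k < n"
  shows "pdX F k x p = gx k"
proof -
  have "((\<lambda>s. F (x(k := s)) p) has_real_derivative
      (\<Sum>l<n. gx l * unitv k l + gp l * 0)) (at (x k) within UNIV)"
    by (rule cdiff_curve[where u = "\<lambda>s. x(k := s)" and w = "\<lambda>s. p"])
       (use assms in \<open>auto simp: sub_upd unitv_def\<close>)
  then show ?thesis using \<open>k < n\<close>
    by (simp add: unitv_expand2 pdX_def DERIV_imp_deriv)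
qed

lemma cdiff_pdP:
  assumes "cdiff n F x p gx gp" "x \<in> sub n" "p \<in> sub n" "k < n"
  shows "pdP F k x p = gp k"
proof -
  have "((\<lambda>s. F x (p(k := s))) has_real_derivative
      (\<Sum>l<n. gx l * 0 + gp l * unitv k l)) (at (p k) within UNIV)"
    by (rule cdiff_curve[where w = "\<lambda>s. p(k := s)" and u = "\<lambda>s. x"])
       (use assms in \<open>auto simp: sub_upd unitv_def\<close>)
  then show ?thesis using \<open>k < n\<close>
    by (simp add: unitv_expand2 pdP_def DERIV_imp_deriv)
qed

lemma cdiff_sum:
  assumes "\<And>i. i \<in> I \<Longrightarrow> cdiff n (F i) x p (gx i) (gp i)"
  shows "cdiff n (\<lambda>x p. \<Sum>i\<in>I. F i x p) x p (\<lambda>k. \<Sum>i\<in>I. gx i k) (\<lambda>k. \<Sum>i\<in>I. gp i k)"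
proof -
  \<comment> \<open>The membership premise stands inside the existential so that choice can be made
    for all \<open>i\<close> at once.\<close>
  have "\<forall>i. \<exists>CX CP. i \<in> I \<longrightarrow> (\<forall>z\<in>sub n \<times> sub n. F i (fst z) (snd z) - F i x p
        = (\<Sum>k<n. CX z k * (fst z k - x k) + CP z k * (snd z k - p k))) \<and>
     (\<forall>k<n. ((\<lambda>z. CX z k) \<longlongrightarrow> gx i k) (near n x p) \<and> ((\<lambda>z. CP z k) \<longlongrightarrow> gp i k) (near n x p))"
    using assms unfolding cdiff_def by blast
  then obtain CX CP where C: "\<And>i z. i \<in> I \<Longrightarrow> z \<in> sub n \<times> sub n \<Longrightarrow> F i (fst z) (snd z) - F i x p
        = (\<Sum>k<n. CX i z k * (fst z k - x k) + CP i z k * (snd z k - p k))"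
    and lim: "\<And>i k. i \<in> I \<Longrightarrow> k < n \<Longrightarrow> ((\<lambda>z. CX i z k) \<longlongrightarrow> gx i k) (near n x p)"
      "\<And>i k. i \<in> I \<Longrightarrow> k < n \<Longrightarrow> ((\<lambda>z. CP i z k) \<longlongrightarrow> gp i k) (near n x p)"
    unfolding choice_iff by blast
  show ?thesis unfolding cdiff_def
  proof (intro exI conjI ballI allI impI)
    fix z assume z: "z \<in> sub n \<times> sub n"
    have "(\<Sum>i\<in>I. F i (fst z) (snd z)) - (\<Sum>i\<in>I. F i x p)
      = (\<Sum>i\<in>I. \<Sum>k<n. CX i z k * (fst z k - x k) + CP i z k * (snd z k - p k))"
      unfolding sum_subtractf[symmetric] by (intro sum.cong refl) (use C z in auto)
    also have "\<dots> = (\<Sum>k<n. (\<Sum>i\<in>I. CX i z k) * (fst z k - x k) + (\<Sum>i\<in>I. CP i z k) * (snd z k - p k))"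
      unfolding sum_distrib_right sum.distrib[symmetric] by (rule sum.swap)
    finally show "(\<Sum>i\<in>I. F i (fst z) (snd z)) - (\<Sum>i\<in>I. F i x p)
      = (\<Sum>k<n. (\<Sum>i\<in>I. CX i z k) * (fst z k - x k) + (\<Sum>i\<in>I. CP i z k) * (snd z k - p k))" .
  qed (auto intro!: tendsto_sum lim)
qed

lemma cdiff_diff:
  assumes "cdiff n F x p gx gp" "cdiff n G x p hx hp"
  shows "cdiff n (\<lambda>x p. F x p - G x p) x p (\<lambda>k. gx k - hx k) (\<lambda>k. gp k - hp k)"
proof -
  obtain CX CP where C: "\<And>z. z \<in> sub n \<times> sub n \<Longrightarrow> F (fst z) (snd z) - F x p
        = (\<Sum>k<n. CX z k * (fst z k - x k) + CP z k * (snd z k - p k))"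
    and lim: "\<And>k. k < n \<Longrightarrow> ((\<lambda>z. CX z k) \<longlongrightarrow> gx k) (near n x p)"
      "\<And>k. k < n \<Longrightarrow> ((\<lambda>z. CP z k) \<longlongrightarrow> gp k) (near n x p)"
    using assms(1) unfolding cdiff_def by blast
  obtain DX DP where D: "\<And>z. z \<in> sub n \<times> sub n \<Longrightarrow> G (fst z) (snd z) - G x p
        = (\<Sum>k<n. DX z k * (fst z k - x k) + DP z k * (snd z k - p k))"
    and lim': "\<And>k. k < n \<Longrightarrow> ((\<lambda>z. DX z k) \<longlongrightarrow> hx k) (near n x p)"
      "\<And>k. k < n \<Longrightarrow> ((\<lambda>z. DP z k) \<longlongrightarrow> hp k) (near n x p)"
    using assms(2) unfolding cdiff_def by blast
  show ?thesis unfolding cdiff_def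
  proof (intro exI conjI ballI allI impI)
    fix z assume z: "z \<in> sub n \<times> sub n"
    have "F (fst z) (snd z) - G (fst z) (snd z) - (F x p - G x p)
      = (F (fst z) (snd z) - F x p) - (G (fst z) (snd z) - G x p)" by simp
    also have "\<dots> = (\<Sum>k<n. (CX z k - DX z k) * (fst z k - x k) + (CP z k - DP z k) * (snd z k - p k))"
      unfolding C[OF z] D[OF z] sum_subtractf[symmetric] by (simp add: algebra_simps)
    finally show "F (fst z) (snd z) - G (fst z) (snd z) - (F x p - G x p)
      = (\<Sum>k<n. (CX z k - DX z k) * (fst z k - x k) + (CP z k - DP z k) * (snd z k - p k))" .
  qed (auto intro!: tendsto_diff lim lim')
qed

lemma cdiff_compose:
  fixes f :: "real \<Rightarrow> real"
  assumes F: "cdiff n F x p gx gp" and f: "(f has_real_derivative d) (at (F x p))"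
  shows "cdiff n (\<lambda>x p. f (F x p)) x p (\<lambda>k. d * gx k) (\<lambda>k. d * gp k)"
proof -
  obtain CX CP where C: "\<And>z. z \<in> sub n \<times> sub n \<Longrightarrow> F (fst z) (snd z) - F x p
        = (\<Sum>k<n. CX z k * (fst z k - x k) + CP z k * (snd z k - p k))"
    and lim: "\<And>k. k < n \<Longrightarrow> ((\<lambda>z. CX z k) \<longlongrightarrow> gx k) (near n x p)"
      "\<And>k. k < n \<Longrightarrow> ((\<lambda>z. CP z k) \<longlongrightarrow> gp k) (near n x p)"
    using F unfolding cdiff_def by blast
  \<comment> \<open>The Caratheodory slope of \<open>f\<close> multiplies the coefficients of
    \<open>F\<close>; it tends to \<open>d\<close> along the filter since \<open>F\<close> itself is
    continuous.\<close>
  obtain g where g: "\<And>y. f y - f (F x p) = g y * (y - F x p)" "isCont g (F x p)" "g (F x p) = d"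
    using f unfolding DERIV_caratheodory_within
    by (metis (no_types, lifting) CARAT_DERIV f)
  have "(g \<longlongrightarrow> d) (nhds (F x p))"
    using g(2,3) unfolding isCont_def by (metis tendsto_at_iff_tendsto_nhds)
  then have G: "((\<lambda>z. g (F (fst z) (snd z))) \<longlongrightarrow> d) (near n x p)"
    by (rule filterlim_compose[OF _ cdiff_continuous[OF F]])
  show ?thesis unfolding cdiff_def
  proof (intro exI conjI ballI allI impI)
    fix z assume z: "z \<in> sub n \<times> sub n"
    show "f (F (fst z) (snd z)) - f (F x p)
      = (\<Sum>k<n. (g (F (fst z) (snd z)) * CX z k) * (fst z k - x k) + (g (F (fst z) (snd z)) * CP z k) * (snd z k - p k))"
      unfolding g(1) C[OF z] by (simp add: sum_distrib_left algebra_simps)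
  qed (auto intro!: tendsto_mult G lim)
qed

lemma pbracket_coord:
  assumes "i < N"
  shows "pbracket N (\<lambda>x p. x i) H x p = pdP H i x p" "pbracket N (\<lambda>x p. p i) H x p = - pdX H i x p"
proof -
  have u: "deriv (\<lambda>s. (v(k := s)) i) (v k) = unitv i k" for v :: "nat \<Rightarrow> real" and k
    by (cases "k = i") (simp_all add: unitv_def)
  have X: "pdX (\<lambda>x p. x i) k x p = unitv i k" "pdP (\<lambda>x p. x i) k x p = 0" for k
    unfolding pdX_def pdP_def u by simp_all
  have P: "pdX (\<lambda>x p. p i) k x p = 0" "pdP (\<lambda>x p. p i) k x p = unitv i k" for k
    unfolding pdX_def pdP_def u by simp_all
  show "pbracket N (\<lambda>x p. x i) H x p = pdP H i x p"
    unfolding pbracket_def X using unitv_expand2[OF assms, of "\<lambda>k. pdP H k x p"] by (simp add: mult.commute)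
  show "pbracket N (\<lambda>x p. p i) H x p = - pdX H i x p"
    unfolding pbracket_def P using unitv_expand2[OF assms, of "\<lambda>k. pdX H k x p"] by (simp add: mult.commute sum_negf)
qed

subsection \<open>Functions of two real variables\<close>

text \<open>The increment is split along an L-shaped path and the mean value theorem is applied on
  each leg. The last two conclusions record that the coefficients are values of the partial
  derivatives, so that they inherit a sign.\<close>

lemma C1_increment:
  fixes f :: "real \<Rightarrow> real \<Rightarrow> real"
  assumes fx: "\<And>x t. ((\<lambda>s. f s t) has_real_derivative fx x t) (at x)"
    and ft: "\<And>x t. ((\<lambda>s. f x s) has_real_derivative ft x t) (at t)"
    and cx: "continuous_on UNIV (\<lambda>(x, t). fx x t)" and ct: "continuous_on UNIV (\<lambda>(x, t). ft x t)"
  obtains a b where "\<And>x' t'. f x' t' - f x t = a x' t' * (x' - x) + b x' t' * (t' - t)"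
    and "((\<lambda>(x', t'). a x' t') \<longlongrightarrow> fx x t) (nhds (x, t))"
    and "((\<lambda>(x', t'). b x' t') \<longlongrightarrow> ft x t) (nhds (x, t))"
    and "\<And>x' t'. \<exists>s r. a x' t' = fx s r" and "\<And>x' t'. \<exists>s r. b x' t' = ft s r"
proof -
  \<comment> \<open>Mean value theorem with the endpoints in any order; the weak bound on the
    intermediate point admits coinciding endpoints.\<close>
  have mvt: "\<exists>z. \<bar>z - c\<bar> \<le> \<bar>d - c\<bar> \<and> g d - g c = g' z * (d - c)"
    if g: "\<And>x. (g has_real_derivative g' x) (at x)" for g g' :: "real \<Rightarrow> real" and c d
  proof (cases c d rule: linorder_cases)
    case less
    then obtain z where "c < z" "z < d" "g d - g c = (d - c) * g' z"
      using MVT2[of c d g g'] g by blast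
    then show ?thesis by (intro exI[of _ z]) (auto simp: mult.commute)
  next
    case greater
    then obtain z where "d < z" "z < c" "g c - g d = (c - d) * g' z"
      using MVT2[of d c g g'] g by blast
    then show ?thesis by (intro exI[of _ z]) (auto simp: algebra_simps)
  qed auto
  have "\<forall>x' t'. \<exists>z. \<bar>z - x\<bar> \<le> \<bar>x' - x\<bar> \<and> f x' t' - f x t' = fx z t' * (x' - x)"
    using mvt[OF fx] by blast
  then obtain \<xi> where \<xi>: "\<And>x' t'. \<bar>\<xi> x' t' - x\<bar> \<le> \<bar>x' - x\<bar>"
      "\<And>x' t'. f x' t' - f x t' = fx (\<xi> x' t') t' * (x' - x)"
    unfolding choice_iff by blast
  have "\<forall>t'. \<exists>z. \<bar>z - t\<bar> \<le> \<bar>t' - t\<bar> \<and> f x t' - f x t = ft x z * (t' - t)"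
    using mvt[OF ft] by blast
  then obtain \<tau> where \<tau>: "\<And>t'. \<bar>\<tau> t' - t\<bar> \<le> \<bar>t' - t\<bar>"
      "\<And>t'. f x t' - f x t = ft x (\<tau> t') * (t' - t)"
    unfolding choice_iff by blast
  have l1: "((\<lambda>z. fst z) \<longlongrightarrow> x) (nhds (x, t))" "((\<lambda>z. snd z) \<longlongrightarrow> t) (nhds (x, t))"
    using continuous_on_UNIV_tendsto_nhds[OF continuous_on_fst[OF continuous_on_id], of "(x, t)"]
      continuous_on_UNIV_tendsto_nhds[OF continuous_on_snd[OF continuous_on_id], of "(x, t)"] by simp_all
  have \<xi>l: "((\<lambda>z. \<xi> (fst z) (snd z)) \<longlongrightarrow> x) (nhds (x, t))"
    by (rule LIM_zero_cancel, rule Lim_null_comparison[of _ "\<lambda>z. \<bar>fst z - x\<bar>"])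
       (use \<xi>(1) l1 in \<open>auto intro!: always_eventually tendsto_rabs_zero LIM_zero\<close>)
  have \<tau>l: "((\<lambda>z. \<tau> (snd z)) \<longlongrightarrow> t) (nhds (x, t))"
    by (rule LIM_zero_cancel, rule Lim_null_comparison[of _ "\<lambda>z. \<bar>snd z - t\<bar>"])
       (use \<tau>(1) l1 in \<open>auto intro!: always_eventually tendsto_rabs_zero LIM_zero\<close>)
  show thesis
  proof (rule that[of "\<lambda>x' t'. fx (\<xi> x' t') t'" "\<lambda>x' t'. ft x (\<tau> t')"])
    show "f x' t' - f x t = fx (\<xi> x' t') t' * (x' - x) + ft x (\<tau> t') * (t' - t)" for x' t'
      using \<xi>(2)[of x' t'] \<tau>(2)[of t'] by simp
    show "((\<lambda>(x', t'). fx (\<xi> x' t') t') \<longlongrightarrow> fx x t) (nhds (x, t))"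
      using continuous_on_tendsto_compose[OF cx tendsto_Pair[OF \<xi>l l1(2)]]
      by (simp add: case_prod_unfold)
    show "((\<lambda>(x', t'). ft x (\<tau> t')) \<longlongrightarrow> ft x t) (nhds (x, t))"
      using continuous_on_tendsto_compose[OF ct tendsto_Pair[OF tendsto_const \<tau>l]]
      by (simp add: case_prod_unfold)
  qed auto
qed

lemma mixed_difference_mvt:
  fixes f :: "real \<Rightarrow> real \<Rightarrow> real"
  assumes fx: "\<And>x t. ((\<lambda>s. f s t) has_real_derivative fx x t) (at x)"
    and fxt: "\<And>x t. ((\<lambda>s. fx x s) has_real_derivative fxt x t) (at t)"
    and h: "h > 0"
  shows "\<exists>\<xi>\<in>{x..x+h}. \<exists>\<tau>\<in>{t..t+h}.
    f (x+h) (t+h) - f (x+h) t - f x (t+h) + f x t = h * h * fxt \<xi> \<tau>"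
proof -
  have "((\<lambda>s. f s (t+h) - f s t) has_real_derivative fx s (t+h) - fx s t) (at s)" for s
    by (intro DERIV_diff fx)
  then have "\<exists>\<xi>. x < \<xi> \<and> \<xi> < x + h \<and> (f (x+h) (t+h) - f (x+h) t) - (f x (t+h) - f x t)
      = (x + h - x) * (fx \<xi> (t+h) - fx \<xi> t)"
    using MVT2[of x "x+h" "\<lambda>s. f s (t+h) - f s t" "\<lambda>s. fx s (t+h) - fx s t"] h
    by simp
  then obtain \<xi> where \<xi>: "x < \<xi>" "\<xi> < x + h" "(f (x+h) (t+h) - f (x+h) t) - (f x (t+h) - f x t)
      = h * (fx \<xi> (t+h) - fx \<xi> t)" by auto
  obtain \<tau> where "t < \<tau>" "\<tau> < t + h" "fx \<xi> (t+h) - fx \<xi> t = h * fxt \<xi> \<tau>"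
    using MVT2[of t "t+h" "fx \<xi>" "fxt \<xi>"] h fxt by auto
  then show ?thesis using \<xi>
    by (intro bexI[of _ \<xi>] bexI[of _ \<tau>]) auto
qed

text \<open>Schwarz's theorem. The mixed second difference over a small square equals the area times
  a value of either mixed partial inside the square; shrinking the square and continuity give
  equality at the corner.\<close>

lemma mixed_partials_equal:
  fixes f :: "real \<Rightarrow> real \<Rightarrow> real"
  assumes fx: "\<And>x t. ((\<lambda>s. f s t) has_real_derivative fx x t) (at x)"
    and ft: "\<And>x t. ((\<lambda>s. f x s) has_real_derivative ft x t) (at t)"
    and fxt: "\<And>x t. ((\<lambda>s. fx x s) has_real_derivative fxt x t) (at t)"
    and ftx: "\<And>x t. ((\<lambda>s. ft s t) has_real_derivative ftx x t) (at x)"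
    and cxt: "continuous_on UNIV (\<lambda>(x, t). fxt x t)" and ctx: "continuous_on UNIV (\<lambda>(x, t). ftx x t)"
  shows "fxt x t = ftx x t"
proof -
  define h :: "nat \<Rightarrow> real" where "h n = 1 / real (Suc n)" for n
  have h: "h n > 0" for n by (simp add: h_def)
  have h0: "h \<longlonglongrightarrow> 0"
    unfolding h_def using LIMSEQ_Suc[OF lim_1_over_n] .
  have "\<forall>n. \<exists>z w. fst z \<in> {x..x + h n} \<and> snd z \<in> {t..t + h n} \<and> fst w \<in> {x..x + h n} \<and> snd w \<in> {t..t + h n}
     \<and> fxt (fst z) (snd z) = ftx (fst w) (snd w)"
  proof
    fix n
    obtain \<xi> \<tau> where 1: "\<xi> \<in> {x..x + h n}" "\<tau> \<in> {t..t + h n}"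
       "f (x+h n) (t+h n) - f (x+h n) t - f x (t+h n) + f x t = h n * h n * fxt \<xi> \<tau>"
      using mixed_difference_mvt[OF fx fxt h] by blast
    \<comment> \<open>The same second difference, with the two arguments of \<open>f\<close>
      exchanged.\<close>
    obtain \<tau>' \<xi>' where 2: "\<xi>' \<in> {x..x + h n}" "\<tau>' \<in> {t..t + h n}"
       "f (x+h n) (t+h n) - f x (t + h n) - f (x+h n) t + f x t = h n * h n * ftx \<xi>' \<tau>'"
      using mixed_difference_mvt[of "\<lambda>t x. f x t" "\<lambda>t x. ft x t" "\<lambda>t x. ftx x t", OF ft ftx h[of n], of t x] by blast
    have "h n * h n * fxt \<xi> \<tau> = h n * h n * ftx \<xi>' \<tau>'"
      using 1(3) 2(3) by linarith
    then have "fxt \<xi> \<tau> = ftx \<xi>' \<tau>'" using h[of n] by simp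
    then show "\<exists>z w. fst z \<in> {x..x + h n} \<and> snd z \<in> {t..t + h n} \<and> fst w \<in> {x..x + h n} \<and> snd w \<in> {t..t + h n}
     \<and> fxt (fst z) (snd z) = ftx (fst w) (snd w)"
      using 1 2 by (intro exI[of _ "(\<xi>, \<tau>)"] exI[of _ "(\<xi>', \<tau>')"]) auto
  qed
  then obtain z w where z: "\<And>n. fst (z n) \<in> {x..x + h n}" "\<And>n. snd (z n) \<in> {t..t + h n}"
    and w: "\<And>n. fst (w n) \<in> {x..x + h n}" "\<And>n. snd (w n) \<in> {t..t + h n}"
    and eq: "\<And>n. fxt (fst (z n)) (snd (z n)) = ftx (fst (w n)) (snd (w n))"
    unfolding choice_iff by blast
  have sq: "a \<longlonglongrightarrow> c" if "\<And>n. a n \<in> {c..c + h n}" for a and c :: real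
  proof (rule tendsto_sandwich[of "\<lambda>_. c" _ _ "\<lambda>n. c + h n"])
    show "(\<lambda>n. c + h n) \<longlonglongrightarrow> c" using tendsto_add[OF tendsto_const h0, of c] by simp
  qed (use that in \<open>auto intro!: always_eventually\<close>)
  have "(\<lambda>n. fxt (fst (z n)) (snd (z n))) \<longlonglongrightarrow> fxt x t"
    using continuous_on_tendsto_compose[OF cxt tendsto_Pair[OF sq[OF z(1)] sq[OF z(2)]]]
    by (simp add: case_prod_unfold)
  moreover have "(\<lambda>n. ftx (fst (w n)) (snd (w n))) \<longlonglongrightarrow> ftx x t"
    using continuous_on_tendsto_compose[OF ctx tendsto_Pair[OF sq[OF w(1)] sq[OF w(2)]]]
    by (simp add: case_prod_unfold)
  ultimately show ?thesis
    unfolding eq by (rule LIMSEQ_unique)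
qed

section \<open>The map omega and the functions theta\<close>

lemma partials_exist_pdx:
  assumes "partials_exist h"
  shows "((\<lambda>s. h s t) has_real_derivative pdx h x t) (at x)"
  unfolding pdx_def DERIV_deriv_iff_real_differentiable
  using assms unfolding partials_exist_def by blast

lemma partials_exist_pdt:
  assumes "partials_exist h"
  shows "((\<lambda>s. h x s) has_real_derivative pdt h x t) (at t)"
  unfolding pdt_def DERIV_deriv_iff_real_differentiable
  using assms unfolding partials_exist_def by blast

text \<open>The factor \<open>c\<close> stands for a parity, which every differentiation flips: the
  first partials of \<open>psi\<close> are odd, the second ones even.\<close>

lemma pdx_reflect:
  assumes h: "partials_exist h" and refl: "\<And>x t. h (- x) (- t) = c * h x t"
  shows "pdx h (- x) (- t) = - c * pdx h x t"
proof -
  have "((\<lambda>s. h (- s) (- t)) has_real_derivative - pdx h (- x) (- t)) (at x)"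
    using partials_exist_pdx[OF h, of "- t" "- x"] by (simp add: DERIV_mirror)
  moreover have "((\<lambda>s. h (- s) (- t)) has_real_derivative c * pdx h x t) (at x)"
    unfolding refl by (intro DERIV_cmult partials_exist_pdx[OF h])
  ultimately show ?thesis
    using DERIV_unique by fastforce
qed

lemma pdt_reflect:
  assumes h: "partials_exist h" and refl: "\<And>x t. h (- x) (- t) = c * h x t"
  shows "pdt h (- x) (- t) = - c * pdt h x t"
proof -
  have "((\<lambda>s. h (- x) (- s)) has_real_derivative - pdt h (- x) (- t)) (at t)"
    using partials_exist_pdt[OF h, of "- x" "- t"] by (simp add: DERIV_mirror)
  moreover have "((\<lambda>s. h (- x) (- s)) has_real_derivative c * pdt h x t) (at t)"
    unfolding refl by (intro DERIV_cmult partials_exist_pdt[OF h])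
  ultimately show ?thesis
    using DERIV_unique by fastforce
qed

lemma mono_if_DERIV_nonneg:
  fixes h :: "real \<Rightarrow> real"
  assumes "\<And>x. (h has_real_derivative h' x) (at x)" "\<And>x. 0 \<le> h' x"
  shows "mono h"
proof (rule monoI)
  fix x y :: real assume "x \<le> y"
  then show "h x \<le> h y"
    by (rule DERIV_nonneg_imp_nondecreasing) (use assms in blast)
qed

text \<open>Instantiated twice: with the given \<open>psi\<close>, and with the zero interaction,
  which represents free particles.\<close>

locale interaction =
  fixes psi :: "real \<Rightarrow> real \<Rightarrow> real"
  assumes C2: "C2 psi"
    and xtheta: "\<And>x t. pdt (pdx psi) x t \<ge> 0"
    and reflect: "\<And>x t. psi (- x) (- t) = psi x t"
begin

abbreviation "\<psi>\<^sub>x \<equiv> pdx psi"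
abbreviation "\<psi>\<^sub>t \<equiv> pdt psi"
abbreviation "\<psi>\<^sub>x\<^sub>x \<equiv> pdx (pdx psi)"
abbreviation "\<psi>\<^sub>x\<^sub>t \<equiv> pdt (pdx psi)"

lemma partials: "partials_exist psi" "partials_exist \<psi>\<^sub>x" "partials_exist \<psi>\<^sub>t"
  using C2 by (auto simp: C2_def)

lemma continuous_partials:
  "continuous_on UNIV (\<lambda>(x, t). \<psi>\<^sub>x x t)"
  "continuous_on UNIV (\<lambda>(x, t). \<psi>\<^sub>x\<^sub>x x t)"
  "continuous_on UNIV (\<lambda>(x, t). \<psi>\<^sub>x\<^sub>t x t)"
  "continuous_on UNIV (\<lambda>(x, t). pdx \<psi>\<^sub>t x t)"
  using C2 by (simp_all add: C2_def)

lemmas DERIV_psi_x_x = partials_exist_pdx[OF partials(2)]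
lemmas DERIV_psi_x_t = partials_exist_pdt[OF partials(2)]

text \<open>Through this identity the derivative of momenta in \<open>th\<close> and that of free
  positions in \<open>x\<close> share one matrix, and monotonicity of \<open>\<psi>\<^sub>t\<close>
  in \<open>x\<close> follows from the same sign condition as that of \<open>\<psi>\<^sub>x\<close>
  in the angle variable.\<close>

lemma mixed: "pdx \<psi>\<^sub>t x t = \<psi>\<^sub>x\<^sub>t x t"
  by (rule mixed_partials_equal[OF partials_exist_pdx[OF partials(1)] partials_exist_pdt[OF partials(1)]
        DERIV_psi_x_t partials_exist_pdx[OF partials(3)] continuous_partials(3,4), symmetric])

lemma DERIV_psi_t_x: "((\<lambda>s. \<psi>\<^sub>t s t) has_real_derivative \<psi>\<^sub>x\<^sub>t x t) (at x)"
  using partials_exist_pdx[OF partials(3), of t x] by (simp add: mixed)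

lemma psi_x_odd: "\<psi>\<^sub>x (- x) (- t) = - \<psi>\<^sub>x x t"
  using pdx_reflect[OF partials(1), of 1] reflect by simp

lemma psi_t_odd: "\<psi>\<^sub>t (- x) (- t) = - \<psi>\<^sub>t x t"
  using pdt_reflect[OF partials(1), of 1] reflect by simp

lemma psi_xx_even: "\<psi>\<^sub>x\<^sub>x (- x) (- t) = \<psi>\<^sub>x\<^sub>x x t"
  using pdx_reflect[OF partials(2), of "- 1"] psi_x_odd by simp

lemma psi_xt_even: "\<psi>\<^sub>x\<^sub>t (- x) (- t) = \<psi>\<^sub>x\<^sub>t x t"
  using pdt_reflect[OF partials(2), of "- 1"] psi_x_odd by simp

text \<open>Vanishing at the origin allows the diagonal term, which \<open>omega\<close> leaves out,
  to be included in the sums.\<close>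

lemma psi_x_0 [simp]: "\<psi>\<^sub>x 0 0 = 0"
  using psi_x_odd[of 0 0] by simp

lemma psi_t_0 [simp]: "\<psi>\<^sub>t 0 0 = 0"
  using psi_t_odd[of 0 0] by simp

lemma mono_psi_x: "mono (\<psi>\<^sub>x x)"
  by (rule mono_if_DERIV_nonneg[OF DERIV_psi_x_t xtheta])

lemma mono_psi_t: "mono (\<lambda>s. \<psi>\<^sub>t s t)"
  by (rule mono_if_DERIV_nonneg[OF DERIV_psi_t_x xtheta])

section \<open>Momenta and free positions as monotone systems\<close>

definition momentum :: "nat \<Rightarrow> (nat \<Rightarrow> real) \<Rightarrow> (nat \<Rightarrow> real) \<Rightarrow> nat \<Rightarrow> real" where
  "momentum N x th = pair_map N (\<lambda>i j s. \<psi>\<^sub>x (x i - x j) s) th"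

text \<open>The vector \<open>y\<close> of the defining equation of \<open>omega\<close>, as a
  function of the solution \<open>x\<close>; it is the quantity that moves freely under the
  flow.\<close>

definition freepos :: "nat \<Rightarrow> (nat \<Rightarrow> real) \<Rightarrow> (nat \<Rightarrow> real) \<Rightarrow> nat \<Rightarrow> real" where
  "freepos N x th = pair_map N (\<lambda>i j s. \<psi>\<^sub>t s (th i - th j)) x"

lemma momentum_in_sub [simp]: "momentum N x th \<in> sub N" and freepos_in_sub [simp]: "freepos N x th \<in> sub N"
  by (simp_all add: momentum_def freepos_def)

lemma momentum_apply: "i < N \<Longrightarrow> momentum N x th i = th i + (\<Sum>j<N. \<psi>\<^sub>x (x i - x j) (th i - th j))"
  by (simp add: momentum_def pair_map_def)

lemma freepos_apply: "i < N \<Longrightarrow> freepos N x th i = x i + (\<Sum>j<N. \<psi>\<^sub>t (x i - x j) (th i - th j))"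
  by (simp add: freepos_def pair_map_def)

lemma momentum_inject: "th \<in> sub N \<Longrightarrow> th' \<in> sub N \<Longrightarrow> momentum N x th = momentum N x th' \<Longrightarrow> th = th'"
  unfolding momentum_def by (rule pair_map_inject) (rule mono_psi_x)

lemma freepos_inject: "x \<in> sub N \<Longrightarrow> x' \<in> sub N \<Longrightarrow> freepos N x th = freepos N x' th \<Longrightarrow> x = x'"
  unfolding freepos_def by (rule pair_map_inject) (rule mono_psi_t)

lemma momentum_surj: "p \<in> sub N \<Longrightarrow> \<exists>th\<in>sub N. momentum N x th = p"
  unfolding momentum_def
  by (rule pair_map_surj) (auto intro: mono_psi_x DERIV_continuous_on[OF DERIV_psi_x_t])

lemma freepos_surj: "y \<in> sub N \<Longrightarrow> \<exists>x\<in>sub N. freepos N x th = y"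
  unfolding freepos_def
  by (rule pair_map_surj) (auto intro: mono_psi_t DERIV_continuous_on[OF DERIV_psi_t_x])

text \<open>Parametrising by \<open>(x, th)\<close> instead of \<open>(y, th)\<close> makes
  \<open>omega\<close> explicit: uniqueness of positions resolves the definite description.\<close>

lemma omega_freepos:
  assumes "x \<in> sub N" "th \<in> sub N"
  shows "omega psi N (freepos N x th) th = (x, momentum N x th)"
proof -
  have t: "(\<Sum>j\<in>{..<N} - {i}. \<psi>\<^sub>t (x' i - x' j) (th i - th j)) = (\<Sum>j<N. \<psi>\<^sub>t (x' i - x' j) (th i - th j))"
    if "i < N" for i x'
    using that by (subst (2) sum.remove[of _ i]) auto
  have p: "(\<Sum>j\<in>{..<N} - {i}. \<psi>\<^sub>x (x i - x j) (th i - th j)) = (\<Sum>j<N. \<psi>\<^sub>x (x i - x j) (th i - th j))"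
    if "i < N" for i
    using that by (subst (2) sum.remove[of _ i]) auto
  have "(\<forall>i<N. freepos N x th i = x' i + (\<Sum>j\<in>{..<N} - {i}. \<psi>\<^sub>t (x' i - x' j) (th i - th j)))
      \<longleftrightarrow> (\<forall>i<N. freepos N x th i = freepos N x' th i)" for x'
    by (simp add: t freepos_apply)
  moreover have "(\<forall>i<N. freepos N x th i = freepos N x' th i) \<longleftrightarrow> freepos N x th = freepos N x' th" for x'
    using sub_eqI[OF freepos_in_sub freepos_in_sub] by metis
  ultimately have eq: "(x' \<in> sub N \<and> (\<forall>i<N. freepos N x th i = x' i + (\<Sum>j\<in>{..<N} - {i}. \<psi>\<^sub>t (x' i - x' j) (th i - th j))))
      \<longleftrightarrow> x' = x" for x'
    using freepos_inject[of x N x' th] assms(1) by auto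
  show ?thesis
    unfolding omega_def eq Let_def the_eq_trivial momentum_def pair_map_def by (auto simp: p)
qed

text \<open>The structure is triangular: equal images have equal \<open>x\<close>, then the momentum
  equation at this \<open>x\<close> gives equal \<open>th\<close>, and \<open>x\<close> and
  \<open>th\<close> together determine \<open>y\<close>.\<close>

lemma inj_on_omega: "inj_on (\<lambda>(y, th). omega psi N y th) (sub N \<times> sub N)"
proof (rule inj_onI)
  fix v v' assume v: "v \<in> sub N \<times> sub N" "v' \<in> sub N \<times> sub N"
    "(case v of (y, th) \<Rightarrow> omega psi N y th) = (case v' of (y, th) \<Rightarrow> omega psi N y th)"
  obtain y th y' th' where vv: "v = (y, th)" "v' = (y', th')" by (metis surj_pair)
  have sub: "y \<in> sub N" "th \<in> sub N" "y' \<in> sub N" "th' \<in> sub N"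
    and eq: "omega psi N y th = omega psi N y' th'" using v vv by simp_all
  obtain x where x: "x \<in> sub N" "freepos N x th = y" using freepos_surj[OF sub(1)] by blast
  obtain x' where x': "x' \<in> sub N" "freepos N x' th' = y'" using freepos_surj[OF sub(3)] by blast
  have "(x, momentum N x th) = (x', momentum N x' th')"
    using eq omega_freepos[OF x(1) sub(2)] omega_freepos[OF x'(1) sub(4)] unfolding x(2) x'(2) by (simp only:)
  then have "x = x'" "momentum N x th = momentum N x th'" by auto
  then have "th = th'" using momentum_inject[OF sub(2,4)] by simp
  then show "v = v'" using x x' \<open>x = x'\<close> vv by simp
qed

text \<open>Together with solvability in \<open>th\<close>, this characterises \<open>theta\<close>
  by the momentum equation, so the inverse of \<open>omega\<close> need not be unfolded
  again.\<close>

lemma theta_momentum: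
  assumes "x \<in> sub N" "th \<in> sub N"
  shows "theta psi N x (momentum N x th) = th"
proof -
  have "omega_inv psi N x (momentum N x th) = (freepos N x th, th)"
    unfolding omega_inv_def
    by (rule the_inv_into_f_eq[OF inj_on_omega]) (use assms omega_freepos in auto)
  then show ?thesis by (simp add: theta_def)
qed

lemma
  assumes "x \<in> sub N" "p \<in> sub N"
  shows theta_in_sub: "theta psi N x p \<in> sub N" and momentum_theta: "momentum N x (theta psi N x p) = p"
proof -
  obtain th where "th \<in> sub N" "momentum N x th = p" using momentum_surj[OF assms(2)] by blast
  then show "theta psi N x p \<in> sub N" "momentum N x (theta psi N x p) = p"
    using theta_momentum[OF assms(1), of th] by simp_all
qed

lemma momentum_theta_apply:
  assumes "x \<in> sub N" "p \<in> sub N" "i < N"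
  shows "p i = theta psi N x p i
    + (\<Sum>j<N. \<psi>\<^sub>x (x i - x j) (theta psi N x p i - theta psi N x p j))"
  using momentum_apply[OF assms(3), of x "theta psi N x p"] unfolding momentum_theta[OF assms(1,2)] .

text \<open>The momenta \<open>momentum N x th\<close> have derivative \<open>lap N (A x th)\<close> in \<open>x\<close> and identity plus
  \<open>lap N (B x th)\<close> in \<open>th\<close>; the latter is also the derivative of \<open>freepos N x th\<close> in \<open>x\<close>.\<close>

definition A :: "(nat \<Rightarrow> real) \<Rightarrow> (nat \<Rightarrow> real) \<Rightarrow> nat \<Rightarrow> nat \<Rightarrow> real" where
  "A x th i j = \<psi>\<^sub>x\<^sub>x (x i - x j) (th i - th j)"

definition B :: "(nat \<Rightarrow> real) \<Rightarrow> (nat \<Rightarrow> real) \<Rightarrow> nat \<Rightarrow> nat \<Rightarrow> real" where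
  "B x th i j = \<psi>\<^sub>x\<^sub>t (x i - x j) (th i - th j)"

lemma nonneg_B: "nonneg N (B x th)"
  by (simp add: nonneg_def B_def xtheta)

lemma symm_A: "symm N (A x th)"
  using psi_xx_even by (simp add: symm_def A_def) (metis minus_diff_eq)

lemma symm_B: "symm N (B x th)"
  using psi_xt_even by (simp add: symm_def B_def) (metis minus_diff_eq)

subsection \<open>Differentiability of theta\<close>

text \<open>The fixed vector \<open>theta psi N x p\<close> is inserted into the momentum equation
  with the positions of the varying point; the mismatch tends to 0, and expansion transfers this to
  \<open>theta\<close>.\<close>

lemma theta_tendsto:
  assumes "x \<in> sub N" "p \<in> sub N" "k < N"
  shows "((\<lambda>z. theta psi N (fst z) (snd z) k) \<longlongrightarrow> theta psi N x p k) (near N x p)"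
proof -
  let ?th = "theta psi N x p"
  have "((\<lambda>z. theta psi N (fst z) (snd z) k - ?th k) \<longlongrightarrow> 0) (near N x p)"
  proof (rule pair_map_tendsto_cancel[where \<phi> = "\<lambda>z i j. \<psi>\<^sub>x (fst z i - fst z j)" and w = "\<lambda>_. ?th"])
    fix i assume i: "i < N"
    have lim: "((\<lambda>z. \<psi>\<^sub>x (fst z i - fst z j) (?th i - ?th j)) \<longlongrightarrow> \<psi>\<^sub>x (x i - x j) (?th i - ?th j)) (near N x p)" for j
      using continuous_on_tendsto_compose[OF continuous_partials(1)
          tendsto_Pair[OF tendsto_diff[OF tendsto_fst_near[of i x p N] tendsto_fst_near[of j x p N]] tendsto_const[of "?th i - ?th j"]]]
      by simp
    have "((\<lambda>z. snd z i - (?th i + (\<Sum>j<N. \<psi>\<^sub>x (fst z i - fst z j) (?th i - ?th j)))) \<longlongrightarrow>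
       p i - (?th i + (\<Sum>j<N. \<psi>\<^sub>x (x i - x j) (?th i - ?th j)))) (near N x p)"
      by (intro tendsto_intros lim tendsto_snd_near)
    moreover have "p i - (?th i + (\<Sum>j<N. \<psi>\<^sub>x (x i - x j) (?th i - ?th j))) = 0"
      using momentum_theta_apply[OF assms(1,2) i] by linarith
    ultimately have "((\<lambda>z. snd z i - (?th i + (\<Sum>j<N. \<psi>\<^sub>x (fst z i - fst z j) (?th i - ?th j)))) \<longlongrightarrow> 0) (near N x p)"
      by (simp only:)
    then show "((\<lambda>z. pair_map N (\<lambda>i j. \<psi>\<^sub>x (fst z i - fst z j)) (theta psi N (fst z) (snd z)) i
        - pair_map N (\<lambda>i j. \<psi>\<^sub>x (fst z i - fst z j)) ?th i) \<longlongrightarrow> 0) (near N x p)"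
    proof (rule Lim_transform_eventually)
      show "\<forall>\<^sub>F z in near N x p. snd z i - (?th i + (\<Sum>j<N. \<psi>\<^sub>x (fst z i - fst z j) (?th i - ?th j)))
         = pair_map N (\<lambda>i j. \<psi>\<^sub>x (fst z i - fst z j)) (theta psi N (fst z) (snd z)) i
        - pair_map N (\<lambda>i j. \<psi>\<^sub>x (fst z i - fst z j)) ?th i"
        using eventually_near_sub
      proof eventually_elim
        case (elim z)
        then have "fst z \<in> sub N" "snd z \<in> sub N" by auto
        from momentum_theta[OF this]
        have "pair_map N (\<lambda>i j. \<psi>\<^sub>x (fst z i - fst z j)) (theta psi N (fst z) (snd z)) = snd z"
          by (simp add: momentum_def)
        then show ?case using i by (simp add: pair_map_def)
      qed
    qed
  qed (use mono_psi_x \<open>k < N\<close> in auto)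
  then show ?thesis by (simp add: LIM_zero_iff)
qed

lemma AB_tendsto:
  assumes "x \<in> sub N" "p \<in> sub N" "i < N" "j < N"
  shows "((\<lambda>z. A (fst z) (theta psi N (fst z) (snd z)) i j) \<longlongrightarrow> A x (theta psi N x p) i j) (near N x p)"
    and "((\<lambda>z. B (fst z) (theta psi N (fst z) (snd z)) i j) \<longlongrightarrow> B x (theta psi N x p) i j) (near N x p)"
proof -
  have l: "((\<lambda>z. (fst z i - fst z j, theta psi N (fst z) (snd z) i - theta psi N (fst z) (snd z) j))
      \<longlongrightarrow> (x i - x j, theta psi N x p i - theta psi N x p j)) (near N x p)"
    by (intro tendsto_Pair tendsto_diff theta_tendsto assms tendsto_fst_near)
  show "((\<lambda>z. A (fst z) (theta psi N (fst z) (snd z)) i j) \<longlongrightarrow> A x (theta psi N x p) i j) (near N x p)"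
    unfolding A_def using continuous_on_tendsto_compose[OF continuous_partials(2) l] by simp
  show "((\<lambda>z. B (fst z) (theta psi N (fst z) (snd z)) i j) \<longlongrightarrow> B x (theta psi N x p) i j) (near N x p)"
    unfolding B_def using continuous_on_tendsto_compose[OF continuous_partials(3) l] by simp
qed

text \<open>Implicit differentiation by hand. Subtracting the momentum equations at two points gives
  an exact linear system for the increment of \<open>theta\<close>; its matrices converge to
  \<open>A\<close> and \<open>B\<close>, and solutions depend continuously on them.\<close>

lemma theta_cdiff:
  assumes sub: "x \<in> sub N" "p \<in> sub N" and i: "i < N"
  defines "th \<equiv> theta psi N x p"
  shows "cdiff N (\<lambda>x p. theta psi N x p i) x p
     (\<lambda>k. - lsolve N (B x th) (lap N (A x th) (unitv k)) i) (\<lambda>k. lsolve N (B x th) (unitv k) i)"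
proof -
  \<comment> \<open>Nonnegativity of \<open>b\<close> is kept along with the increments, because it
    makes the perturbed system solvable and not merely the limiting one.\<close>
  have "\<forall>i j. \<exists>a b. (\<forall>x' t'. \<psi>\<^sub>x x' t' - \<psi>\<^sub>x (x i - x j) (th i - th j)
        = a x' t' * (x' - (x i - x j)) + b x' t' * (t' - (th i - th j))) \<and>
      ((\<lambda>z. a (fst z) (snd z)) \<longlongrightarrow> A x th i j) (nhds (x i - x j, th i - th j)) \<and>
      ((\<lambda>z. b (fst z) (snd z)) \<longlongrightarrow> B x th i j) (nhds (x i - x j, th i - th j)) \<and>
      (\<forall>x' t'. 0 \<le> b x' t')"
  proof (intro allI)
    fix i j
    show "\<exists>a b. (\<forall>x' t'. \<psi>\<^sub>x x' t' - \<psi>\<^sub>x (x i - x j) (th i - th j)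
        = a x' t' * (x' - (x i - x j)) + b x' t' * (t' - (th i - th j))) \<and>
      ((\<lambda>z. a (fst z) (snd z)) \<longlongrightarrow> A x th i j) (nhds (x i - x j, th i - th j)) \<and>
      ((\<lambda>z. b (fst z) (snd z)) \<longlongrightarrow> B x th i j) (nhds (x i - x j, th i - th j)) \<and>
      (\<forall>x' t'. 0 \<le> b x' t')"
    proof (rule C1_increment[OF DERIV_psi_x_x DERIV_psi_x_t continuous_partials(2,3), of "x i - x j" "th i - th j"])
      fix a b
      assume h: "\<And>x' t'. \<psi>\<^sub>x x' t' - \<psi>\<^sub>x (x i - x j) (th i - th j)
          = a x' t' * (x' - (x i - x j)) + b x' t' * (t' - (th i - th j))"
        "((\<lambda>(x', t'). a x' t') \<longlongrightarrow> \<psi>\<^sub>x\<^sub>x (x i - x j) (th i - th j)) (nhds (x i - x j, th i - th j))"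
        "((\<lambda>(x', t'). b x' t') \<longlongrightarrow> \<psi>\<^sub>x\<^sub>t (x i - x j) (th i - th j)) (nhds (x i - x j, th i - th j))"
        "\<And>x' t'. \<exists>s r. b x' t' = \<psi>\<^sub>x\<^sub>t s r"
      have "0 \<le> b x' t'" for x' t' using h(4)[of x' t'] xtheta by auto
      then show ?thesis
        using h(1,2,3) unfolding A_def B_def case_prod_unfold by blast
    qed
  qed
  then obtain a b where inc: "\<And>i j x' t'. \<psi>\<^sub>x x' t' - \<psi>\<^sub>x (x i - x j) (th i - th j)
        = a i j x' t' * (x' - (x i - x j)) + b i j x' t' * (t' - (th i - th j))"
    and a: "\<And>i j. ((\<lambda>z. a i j (fst z) (snd z)) \<longlongrightarrow> A x th i j) (nhds (x i - x j, th i - th j))"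
    and b: "\<And>i j. ((\<lambda>z. b i j (fst z) (snd z)) \<longlongrightarrow> B x th i j) (nhds (x i - x j, th i - th j))"
    and b0: "\<And>i j x' t'. 0 \<le> b i j x' t'"
    unfolding choice_iff by blast
  define T where "T = (\<lambda>z. theta psi N (fst z) (snd z))"
  define A' where "A' = (\<lambda>z i j. a i j (fst z i - fst z j) (T z i - T z j))"
  define B' where "B' = (\<lambda>z i j. b i j (fst z i - fst z j) (T z i - T z j))"
  have nn: "nonneg N (B' z)" for z
    by (simp add: nonneg_def B'_def b0)
  have l: "((\<lambda>z. (fst z i - fst z j, T z i - T z j)) \<longlongrightarrow> (x i - x j, th i - th j)) (near N x p)"
    if "i < N" "j < N" for i j
    unfolding T_def th_def by (intro tendsto_Pair tendsto_diff theta_tendsto sub that tendsto_fst_near)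
  have A': "((\<lambda>z. A' z i j) \<longlongrightarrow> A x th i j) (near N x p)" if "i < N" "j < N" for i j
    unfolding A'_def using filterlim_compose[OF a l[OF that]] by simp
  have B': "((\<lambda>z. B' z i j) \<longlongrightarrow> B x th i j) (near N x p)" if "i < N" "j < N" for i j
    unfolding B'_def using filterlim_compose[OF b l[OF that]] by simp
  show ?thesis unfolding cdiff_def
  proof (intro exI conjI ballI allI impI)
    fix z assume z: "z \<in> sub N \<times> sub N"
    let ?dx = "\<lambda>k. fst z k - x k" and ?dp = "\<lambda>k. snd z k - p k" and ?dt = "\<lambda>k. T z k - th k"
    \<comment> \<open>An identity without remainder, valid at every \<open>z\<close> in phase space:
      \<open>A'\<close> and \<open>B'\<close> depend on \<open>z\<close> and absorb all
      nonlinearity.\<close>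
    have "?dt l + lap N (B' z) ?dt l = ?dp l - lap N (A' z) ?dx l" if l: "l < N" for l
    proof -
      have "snd z l = T z l + (\<Sum>j<N. \<psi>\<^sub>x (fst z l - fst z j) (T z l - T z j))"
        unfolding T_def by (rule momentum_theta_apply) (use z l in auto)
      moreover have "p l = th l + (\<Sum>j<N. \<psi>\<^sub>x (x l - x j) (th l - th j))"
        unfolding th_def using momentum_theta_apply[OF sub l] .
      ultimately have "?dp l = ?dt l + (\<Sum>j<N. \<psi>\<^sub>x (fst z l - fst z j) (T z l - T z j) - \<psi>\<^sub>x (x l - x j) (th l - th j))"
        by (simp add: sum_subtractf)
      also have "(\<Sum>j<N. \<psi>\<^sub>x (fst z l - fst z j) (T z l - T z j) - \<psi>\<^sub>x (x l - x j) (th l - th j))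
         = (\<Sum>j<N. A' z l j * (?dx l - ?dx j) + B' z l j * (?dt l - ?dt j))"
        unfolding inc by (intro sum.cong refl) (simp add: A'_def B'_def algebra_simps)
      also have "\<dots> = lap N (A' z) ?dx l + lap N (B' z) ?dt l"
        by (simp add: lap_def sum.distrib)
      finally show ?thesis by simp
    qed
    then have "?dt i = lsolve N (B' z) (\<lambda>l. ?dp l - lap N (A' z) ?dx l) i"
      by (rule lsolve_unique[OF nn _ i])
    also have "\<dots> = lsolve N (B' z) ?dp i - lsolve N (B' z) (lap N (A' z) ?dx) i"
      by (rule lsolve_diff[OF nn i])
    also have "lsolve N (B' z) ?dp = lsolve N (B' z) (\<lambda>l. \<Sum>k<N. ?dp k * unitv k l)"
      by (rule lsolve_cong) (simp add: unitv_expand)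
    also have "lsolve N (B' z) (lap N (A' z) ?dx) = lsolve N (B' z) (\<lambda>l. \<Sum>k<N. ?dx k * lap N (A' z) (unitv k) l)"
      by (rule lsolve_cong) (rule lap_expand)
    finally show "theta psi N (fst z) (snd z) i - theta psi N x p i
       = (\<Sum>k<N. (- lsolve N (B' z) (lap N (A' z) (unitv k)) i) * ?dx k + lsolve N (B' z) (unitv k) i * ?dp k)"
      unfolding lsolve_sum[OF nn i] T_def th_def
      by (simp add: sum_subtractf mult.commute)
  next
    fix k assume "k < N"
    show "((\<lambda>z. - lsolve N (B' z) (lap N (A' z) (unitv k)) i)
        \<longlongrightarrow> - lsolve N (B x th) (lap N (A x th) (unitv k)) i) (near N x p)"
      by (intro tendsto_minus lsolve_tendsto nn B' nonneg_B i)
         (auto simp: lap_def intro!: tendsto_sum tendsto_mult A')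
    show "((\<lambda>z. lsolve N (B' z) (unitv k) i) \<longlongrightarrow> lsolve N (B x th) (unitv k) i) (near N x p)"
      by (intro lsolve_tendsto nn B' nonneg_B i tendsto_const)
  qed
qed

section \<open>Gradients and brackets of the functions
  \<open>\<Sum>i<N. f (theta psi N x p i)\<close>\<close>

lemma sum_theta_cdiff:
  assumes sub: "x \<in> sub N" "p \<in> sub N"
    and f: "\<And>t. (f has_real_derivative f' t) (at t)"
  defines "th \<equiv> theta psi N x p"
  defines "u \<equiv> lsolve N (B x th) (\<lambda>i. f' (th i))"
  shows "cdiff N (\<lambda>x p. \<Sum>i<N. f (theta psi N x p i)) x p (\<lambda>k. - lap N (A x th) u k) u"
proof (rule cdiff_cong)
  show "cdiff N (\<lambda>x p. \<Sum>i<N. f (theta psi N x p i)) x p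
     (\<lambda>k. \<Sum>i<N. f' (th i) * (- lsolve N (B x th) (lap N (A x th) (unitv k)) i))
     (\<lambda>k. \<Sum>i<N. f' (th i) * lsolve N (B x th) (unitv k) i)"
    unfolding th_def by (intro cdiff_sum cdiff_compose theta_cdiff sub f) auto
next
  fix k assume k: "k < N"
  \<comment> \<open>Self-adjointness of the inverse and of the Laplacian moves both operators off
    the unit vector and onto \<open>f'\<close>, which leaves a single coordinate.\<close>
  have "(\<Sum>i<N. f' (th i) * lsolve N (B x th) (lap N (A x th) (unitv k)) i)
     = (\<Sum>i<N. u i * lap N (A x th) (unitv k) i)"
    unfolding u_def by (rule lsolve_symm[OF symm_B nonneg_B])
  also have "\<dots> = (\<Sum>i<N. lap N (A x th) u i * unitv k i)"
    by (rule lap_symm[OF symm_A])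
  also have "\<dots> = lap N (A x th) u k" using unitv_expand2[OF k] .
  finally show "(\<Sum>i<N. f' (th i) * (- lsolve N (B x th) (lap N (A x th) (unitv k)) i))
     = - lap N (A x th) u k"
    by (simp add: sum_negf)
  have "(\<Sum>i<N. f' (th i) * lsolve N (B x th) (unitv k) i) = (\<Sum>i<N. u i * unitv k i)"
    unfolding u_def by (rule lsolve_symm[OF symm_B nonneg_B])
  then show "(\<Sum>i<N. f' (th i) * lsolve N (B x th) (unitv k) i) = u k"
    using unitv_expand2[OF k] by simp
qed

lemma sum_theta_grad_tendsto:
  fixes f' :: "real \<Rightarrow> real"
  assumes sub: "x \<in> sub N" "p \<in> sub N" and f': "continuous_on UNIV f'" and k: "k < N"
  defines "th \<equiv> \<lambda>x p. theta psi N x p"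
  defines "u \<equiv> \<lambda>x p. lsolve N (B x (th x p)) (\<lambda>i. f' (th x p i))"
  shows "((\<lambda>z. u (fst z) (snd z) k) \<longlongrightarrow> u x p k) (near N x p)"
    and "((\<lambda>z. - lap N (A (fst z) (th (fst z) (snd z))) (u (fst z) (snd z)) k)
        \<longlongrightarrow> - lap N (A x (th x p)) (u x p) k) (near N x p)"
proof -
  have u: "((\<lambda>z. u (fst z) (snd z) k) \<longlongrightarrow> u x p k) (near N x p)" if "k < N" for k
    unfolding u_def th_def
    by (rule lsolve_tendsto) (auto intro!: nonneg_B AB_tendsto sub that
        continuous_on_tendsto_compose[OF f'] theta_tendsto)
  then show "((\<lambda>z. u (fst z) (snd z) k) \<longlongrightarrow> u x p k) (near N x p)" using k .
  show "((\<lambda>z. - lap N (A (fst z) (th (fst z) (snd z))) (u (fst z) (snd z)) k)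
        \<longlongrightarrow> - lap N (A x (th x p)) (u x p) k) (near N x p)"
    unfolding lap_def using u k unfolding th_def
    by (intro tendsto_minus tendsto_sum tendsto_mult tendsto_diff AB_tendsto sub) auto
qed

lemma sum_theta_C1:
  assumes "\<And>t. (f has_real_derivative f' t) (at t)" "continuous_on UNIV f'"
  shows "C1 N (\<lambda>x p. \<Sum>i<N. f (theta psi N x p i))"
  by (rule C1_I[OF sum_theta_cdiff[OF _ _ assms(1)]])
     (auto intro: sum_theta_grad_tendsto[OF _ _ assms(2)])

text \<open>With \<open>L = lap N ?A\<close> the bracket is the pairing of \<open>?u\<close> with
  \<open>L ?w\<close> minus that of \<open>L ?u\<close> with \<open>?w\<close>, which vanishes
  because \<open>L\<close> is self-adjoint.\<close>

lemma sum_theta_pbracket: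
  assumes sub: "x \<in> sub N" "p \<in> sub N"
    and f: "\<And>t. (f has_real_derivative f' t) (at t)" and g: "\<And>t. (g has_real_derivative g' t) (at t)"
  shows "pbracket N (\<lambda>x p. \<Sum>i<N. f (theta psi N x p i)) (\<lambda>x p. \<Sum>i<N. g (theta psi N x p i)) x p = 0"
proof -
  note F = sum_theta_cdiff[OF sub f] and G = sum_theta_cdiff[OF sub g]
  let ?th = "theta psi N x p"
  let ?A = "A x ?th" and ?u = "lsolve N (B x ?th) (\<lambda>i. f' (?th i))" and ?w = "lsolve N (B x ?th) (\<lambda>i. g' (?th i))"
  have "pbracket N (\<lambda>x p. \<Sum>i<N. f (theta psi N x p i)) (\<lambda>x p. \<Sum>i<N. g (theta psi N x p i)) x p
    = (\<Sum>k<N. - lap N ?A ?u k * ?w k - ?u k * (- lap N ?A ?w k))"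
    unfolding pbracket_def
    by (intro sum.cong refl) (simp add: cdiff_pdX[OF F sub] cdiff_pdX[OF G sub] cdiff_pdP[OF F sub] cdiff_pdP[OF G sub])
  also have "\<dots> = (\<Sum>k<N. ?u k * lap N ?A ?w k) - (\<Sum>k<N. lap N ?A ?u k * ?w k)"
    unfolding sum_subtractf[symmetric] by (intro sum.cong refl) simp
  also have "\<dots> = 0" using lap_symm[OF symm_A] by simp
  finally show ?thesis .
qed

end

text \<open>A polynomial of degree at most \<open>n - 1\<close> with \<open>n\<close> distinct roots
  is zero. The factor \<open>real a\<close> from differentiating powers is harmless as
  \<open>a\<close> starts at 1.\<close>

lemma poly_with_n_roots_zero:
  fixes c t :: "nat \<Rightarrow> real"
  assumes inj: "inj_on t {..<n}" and zero: "\<And>i. i < n \<Longrightarrow> (\<Sum>a=1..n. c a * (real a * t i ^ (a - 1))) = 0"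
    and a: "a \<in> {1..n}"
  shows "c a = 0"
proof (rule ccontr)
  assume "c a \<noteq> 0"
  define d where "d = (\<lambda>i. c (Suc i) * real (Suc i))"
  have eq: "(\<Sum>a=1..n. c a * (real a * s ^ (a - 1))) = (\<Sum>i\<le>n - 1. d i * s ^ i)" for s
  proof -
    have "(\<Sum>a=1..n. c a * (real a * s ^ (a - 1))) = (\<Sum>i<n. d i * s ^ i)"
      by (simp add: sum.atLeast1_atMost_eq d_def mult.assoc)
    \<comment> \<open>Needs \<open>n > 0\<close>, which membership of \<open>a\<close> in
      \<open>{1..n}\<close> provides.\<close>
    also have "{..<n} = {..n - 1}" using a by auto
    finally show ?thesis .
  qed
  have "d (a - 1) \<noteq> 0" "a - 1 \<le> n - 1"
    using a \<open>c a \<noteq> 0\<close> by (auto simp: d_def)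
  then have fin: "finite {s. (\<Sum>i\<le>n - 1. d i * s ^ i) = 0}"
    and card: "card {s. (\<Sum>i\<le>n - 1. d i * s ^ i) = 0} \<le> n - 1"
    using Transcendental.polyfun_rootbound[of d "a - 1" "n - 1"] by auto
  have "t ` {..<n} \<subseteq> {s. (\<Sum>i\<le>n - 1. d i * s ^ i) = 0}"
    using zero unfolding eq by auto
  then have "card (t ` {..<n}) \<le> n - 1"
    using card_mono[OF fin] card by (meson order_trans)
  then show False using card_image[OF inj] a by auto
qed

text \<open>Equal entries are separated by every nonzero \<open>s\<close>, and distinct entries stay
  apart for small \<open>s\<close>; only finitely many pairs occur.\<close>

lemma eventually_perturbation_inj:
  fixes t :: "nat \<Rightarrow> real"
  shows "\<forall>\<^sub>F s in at 0. inj_on (\<lambda>i. t i + s * real i) {..<n}"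
proof -
  have "\<forall>\<^sub>F s in at 0. i \<noteq> j \<longrightarrow> t i + s * real i \<noteq> t j + s * real j" for i j
  proof (cases "t i = t j")
    case True
    have "\<forall>\<^sub>F s in at (0::real). s \<noteq> 0" by (simp add: eventually_at_filter)
    then show ?thesis by eventually_elim (use True in auto)
  next
    case False
    have "((\<lambda>s. (t i + s * real i) - (t j + s * real j)) \<longlongrightarrow> (t i + 0 * real i) - (t j + 0 * real j)) (at 0)"
      by (intro tendsto_intros)
    then have "\<forall>\<^sub>F s in at 0. (t i + s * real i) - (t j + s * real j) \<noteq> 0"
      by (rule tendsto_imp_eventually_ne) (use False in simp)
    then show ?thesis by eventually_elim auto
  qed
  then have "\<forall>\<^sub>F s in at 0. \<forall>i\<in>{..<n}. \<forall>j\<in>{..<n}. i \<noteq> j \<longrightarrow> t i + s * real i \<noteq> t j + s * real j"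
    by (intro eventually_ball_finite ballI) auto
  then show ?thesis
    by eventually_elim (auto simp: inj_on_def)
qed

lemma DERIV_power_nat: "((\<lambda>t::real. t ^ a) has_real_derivative real a * t ^ (a - 1)) (at t)"
  using DERIV_pow[of a t UNIV] by simp

lemma DERIV_half_square: "((\<lambda>t::real. t\<^sup>2 / 2) has_real_derivative t) (at t)"
  by (auto intro!: derivative_eq_intros)

section \<open>Regularity of \<open>Qpsi\<close> and \<open>Hpsi\<close>\<close>

context interaction
begin

lemma Qpsi_eq: "Qpsi psi N a = (\<lambda>x p. \<Sum>i<N. (theta psi N x p i) ^ a)"
  by (simp add: Qpsi_def fun_eq_iff)

lemma Hpsi_eq: "Hpsi psi N = (\<lambda>x p. \<Sum>i<N. (theta psi N x p i)\<^sup>2 / 2)"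
  by (simp add: Hpsi_def fun_eq_iff sum_divide_distrib)

lemmas Qpsi_cdiff = sum_theta_cdiff[OF _ _ DERIV_power_nat, folded Qpsi_eq]
lemmas Hpsi_cdiff = sum_theta_cdiff[OF _ _ DERIV_half_square, folded Hpsi_eq]

lemma Qpsi_C1: "C1 N (Qpsi psi N a)"
  unfolding Qpsi_eq by (rule sum_theta_C1[OF DERIV_power_nat]) (intro continuous_intros)

lemma Hpsi_C1: "C1 N (Hpsi psi N)"
  unfolding Hpsi_eq by (rule sum_theta_C1[OF DERIV_half_square]) (rule continuous_on_id)

subsection \<open>Functional independence\<close>

text \<open>A vanishing combination of the momentum gradients is the solution of a linear system
  with right side \<open>\<Sum>a=1..N. c a * (real a * ?th i ^ (a - 1))\<close>. A zero solution
  forces a zero right side, that is, a polynomial with \<open>N\<close> distinct roots.\<close>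

lemma Qpsi_independent_at:
  assumes sub: "x \<in> sub N" "p \<in> sub N" and inj: "inj_on (theta psi N x p) {..<N}"
    and zero: "\<And>k. k < N \<Longrightarrow> (\<Sum>a=1..N. c a * pdP (Qpsi psi N a) k x p) = 0" and a: "a \<in> {1..N}"
  shows "c a = 0"
proof (rule poly_with_n_roots_zero[OF inj _ a])
  let ?th = "theta psi N x p"
  let ?v = "\<lambda>i. \<Sum>a=1..N. c a * (real a * ?th i ^ (a - 1))"
  have "lsolve N (B x ?th) ?v k = 0" if k: "k < N" for k
  proof -
    have "lsolve N (B x ?th) ?v k
      = (\<Sum>a=1..N. c a * lsolve N (B x ?th) (\<lambda>i. real a * ?th i ^ (a - 1)) k)"
      by (rule lsolve_sum[OF nonneg_B k])
    also have "\<dots> = (\<Sum>a=1..N. c a * pdP (Qpsi psi N a) k x p)"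
      by (simp add: cdiff_pdP[OF Qpsi_cdiff[OF sub] sub k])
    finally show ?thesis using zero[OF k] by simp
  qed
  then show "?v i = 0" if "i < N" for i
    using lsolve_eq[OF nonneg_B that, of x ?th ?v] that by (simp add: lap_def)
qed

text \<open>At fixed \<open>x\<close>, coinciding entries of \<open>theta\<close> are separated by
  adding \<open>s * real i\<close>; the corresponding momenta tend to \<open>p\<close> as
  \<open>s\<close> tends to 0.\<close>

lemma dense_distinct_theta:
  assumes sub: "x \<in> sub N" "p \<in> sub N"
  shows "(x, p) \<in> closure {z \<in> sub N \<times> sub N. inj_on (theta psi N (fst z) (snd z)) {..<N}}"
    (is "_ \<in> closure ?S")
proof -
  let ?th = "theta psi N x p"
  define t where "t = (\<lambda>s i. if i < N then ?th i + s * real i else 0)"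
  have t: "t s \<in> sub N" for s by (simp add: t_def sub_def)
  have tl: "((\<lambda>s. t s i) \<longlongrightarrow> ?th i) (at 0)" if "i < N" for i
  proof -
    have "((\<lambda>s. ?th i + s * real i) \<longlongrightarrow> ?th i + 0 * real i) (at 0)"
      by (intro tendsto_intros)
    then show ?thesis using that by (simp add: t_def)
  qed
  have "((\<lambda>s. momentum N x (t s) i) \<longlongrightarrow> p i) (at 0)" for i
  proof (cases "i < N")
    case True
    have "((\<lambda>s. \<psi>\<^sub>x (x i - x j) (t s i - t s j)) \<longlongrightarrow> \<psi>\<^sub>x (x i - x j) (?th i - ?th j)) (at 0)" if "j < N" for j
    proof (rule continuous_on_tendsto_compose[of UNIV "\<psi>\<^sub>x (x i - x j)"])
      show "continuous_on UNIV (\<psi>\<^sub>x (x i - x j))"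
        by (rule DERIV_continuous_on[OF DERIV_psi_x_t])
    qed (use tl True that in \<open>auto intro!: tendsto_diff\<close>)
    then have "((\<lambda>s. t s i + (\<Sum>j<N. \<psi>\<^sub>x (x i - x j) (t s i - t s j)))
      \<longlongrightarrow> ?th i + (\<Sum>j<N. \<psi>\<^sub>x (x i - x j) (?th i - ?th j))) (at 0)"
      by (intro tendsto_intros tl True) auto
    then show ?thesis
      unfolding momentum_theta_apply[OF sub True, symmetric] by (simp add: momentum_apply True)
  next
    case False
    then have "momentum N x (t s) i = p i" for s
      using momentum_in_sub[of N x "t s"] sub(2) by (auto simp: sub_def)
    then show ?thesis by simp
  qed
  then have "((\<lambda>s. momentum N x (t s)) \<longlongrightarrow> p) (at 0)" by (rule tendsto_coordinatewise)
  then have lim: "((\<lambda>s. (x, momentum N x (t s))) \<longlongrightarrow> (x, p)) (at 0)"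
    by (intro tendsto_intros)
  have "\<forall>\<^sub>F s in at 0. (x, momentum N x (t s)) \<in> closure ?S"
    using eventually_perturbation_inj[of ?th N]
  proof eventually_elim
    case (elim s)
    have "inj_on (t s) {..<N}"
      using elim by (simp add: t_def inj_on_def)
    then have "(x, momentum N x (t s)) \<in> ?S"
      using sub(1) theta_momentum[OF sub(1) t, of s] by simp
    then show ?case by (rule subsetD[OF closure_subset])
  qed
  then show ?thesis
    by (rule Lim_in_closed_set[OF closed_closure _ _ lim]) simp
qed

text \<open>The open dense set is where the entries of \<open>theta\<close> are pairwise distinct: a
  finite intersection of preimages of the nonzero reals.\<close>

lemma Qpsi_func_indep: "func_indep N (Qpsi psi N)"
proof -
  let ?S = "{z \<in> sub N \<times> sub N. inj_on (theta psi N (fst z) (snd z)) {..<N}}"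
  let ?T = "sub N \<times> sub N :: ((nat \<Rightarrow> real) \<times> (nat \<Rightarrow> real)) set"
  have cont: "continuous_on ?T (\<lambda>z. theta psi N (fst z) (snd z) i)" if "i < N" for i
    unfolding continuous_on_def
  proof
    fix z assume "z \<in> ?T"
    then have "((\<lambda>z. theta psi N (fst z) (snd z) i) \<longlongrightarrow> theta psi N (fst z) (snd z) i) (near N (fst z) (snd z))"
      by (intro theta_tendsto that) auto
    then show "((\<lambda>z. theta psi N (fst z) (snd z) i) \<longlongrightarrow> theta psi N (fst z) (snd z) i) (at z within ?T)"
      by (rule filterlim_mono[OF _ order_refl at_within_le_near])
  qed
  define I where "I = {(i, j). i < N \<and> j < N \<and> i \<noteq> j}"
  define U where "U = (\<lambda>(i, j). ?T \<inter> (\<lambda>z. theta psi N (fst z) (snd z) i - theta psi N (fst z) (snd z) j) -` (- {0}))"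
  have "openin (top_of_set ?T) (U ij)" if "ij \<in> I" for ij
  proof -
    obtain i j where ij: "ij = (i, j)" "i < N" "j < N" using \<open>ij \<in> I\<close> by (auto simp: I_def)
    have "openin (top_of_set ?T) (?T \<inter> (\<lambda>z. theta psi N (fst z) (snd z) i - theta psi N (fst z) (snd z) j) -` (- {0}))"
      using ij by (intro continuous_openin_preimage_gen continuous_on_diff cont) auto
    then show ?thesis by (simp add: U_def ij)
  qed
  moreover have "finite I" unfolding I_def by (rule finite_subset[of _ "{..<N} \<times> {..<N}"]) auto
  \<comment> \<open>Inserting \<open>?T\<close> covers the case of no pairs,
    \<open>N \<le> 1\<close>, where the intersection would otherwise be the whole type.\<close>
  ultimately have "openin (top_of_set ?T) (\<Inter>(insert ?T (U ` I)))"
    by (intro openin_Inter) auto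
  moreover have "\<Inter>(insert ?T (U ` I)) = ?S"
    by (auto simp: U_def I_def inj_on_def)
  ultimately have "openin (top_of_set ?T) ?S" by simp
  moreover have "?T \<subseteq> closure ?S"
    using dense_distinct_theta by auto
  moreover have "\<forall>(x, p)\<in>?S. \<forall>c. (\<forall>k<N. (\<Sum>a=1..N. c a * pdX (Qpsi psi N a) k x p) = 0 \<and>
      (\<Sum>a=1..N. c a * pdP (Qpsi psi N a) k x p) = 0) \<longrightarrow> (\<forall>a\<in>{1..N}. c a = 0)"
    using Qpsi_independent_at by auto
  ultimately show ?thesis unfolding func_indep_def by blast
qed

section \<open>Commutation and Liouville integrability\<close>

lemma Qpsi_pbracket:
  assumes "x \<in> sub N" "p \<in> sub N"
  shows "pbracket N (Qpsi psi N a) (Qpsi psi N b) x p = 0" "pbracket N (Qpsi psi N a) (Hpsi psi N) x p = 0"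
  unfolding Qpsi_eq Hpsi_eq
  by (rule sum_theta_pbracket[OF assms DERIV_power_nat DERIV_power_nat])
     (rule sum_theta_pbracket[OF assms DERIV_power_nat DERIV_half_square])

lemma Hpsi_liouville: "liouville_with N (Hpsi psi N) (Qpsi psi N)"
  unfolding liouville_with_def
  using Hpsi_C1 Qpsi_C1 Qpsi_func_indep Qpsi_pbracket by simp

subsection \<open>The flow\<close>

text \<open>The velocity forced by \<open>freepos N x th = y + t * th\<close> at fixed
  \<open>th\<close>, and at the same time the momentum gradient of \<open>Hpsi\<close>.\<close>

definition vel :: "nat \<Rightarrow> (nat \<Rightarrow> real) \<Rightarrow> (nat \<Rightarrow> real) \<Rightarrow> nat \<Rightarrow> real" where
  "vel N x th = lsolve N (B x th) th"

lemma hamilton_vector_field: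
  assumes "x \<in> sub N" "p \<in> sub N" "i < N"
  defines "th \<equiv> theta psi N x p"
  shows "pbracket N (\<lambda>x p. x i) (Hpsi psi N) x p = vel N x th i"
    and "pbracket N (\<lambda>x p. p i) (Hpsi psi N) x p = lap N (A x th) (vel N x th) i"
  using cdiff_pdP[OF Hpsi_cdiff[OF assms(1,2)] assms(1-3)] cdiff_pdX[OF Hpsi_cdiff[OF assms(1,2)] assms(1-3)]
  unfolding pbracket_coord[OF assms(3)] vel_def th_def by simp_all

text \<open>Only the equation is assumed of \<open>X\<close>. Expansion first gives continuity; then
  the difference quotients solve linear systems with nonnegative weights that converge to the system
  defining \<open>vel\<close>.\<close>

lemma freepos_curve_derivative:
  assumes "\<And>s. freepos N (X s) th = (\<lambda>i. y i + s * th i)" "i < N"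
  shows "((\<lambda>s. X s i) has_real_derivative vel N (X t) th i) (at t)"
proof -
  have "\<forall>i j. \<exists>b. (\<forall>x'. \<psi>\<^sub>t x' (th i - th j) - \<psi>\<^sub>t (X t i - X t j) (th i - th j)
        = b x' * (x' - (X t i - X t j))) \<and> isCont b (X t i - X t j) \<and> b (X t i - X t j) = B (X t) th i j"
    unfolding B_def using DERIV_psi_t_x unfolding CARAT_DERIV by metis
  then obtain b where inc: "\<And>i j x'. \<psi>\<^sub>t x' (th i - th j) - \<psi>\<^sub>t (X t i - X t j) (th i - th j)
        = b i j x' * (x' - (X t i - X t j))"
    and cont: "\<And>i j. isCont (b i j) (X t i - X t j)" and b: "\<And>i j. b i j (X t i - X t j) = B (X t) th i j"
    unfolding choice_iff by blast
  \<comment> \<open>Away from the base point the slope of \<open>\<psi>\<^sub>t\<close> is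
    nonnegative by monotonicity, at the base point by the sign of the mixed derivative.\<close>
  have b0: "0 \<le> b i j x'" for i j x'
  proof (cases x' "X t i - X t j" rule: linorder_cases)
    case equal
    then show ?thesis using b[of i j] xtheta by (simp add: B_def)
  next
    case less
    then have "b i j x' * (x' - (X t i - X t j)) \<le> 0"
      using monoD[OF mono_psi_t[of "th i - th j"], of x' "X t i - X t j"] by (simp flip: inc)
    then show ?thesis using less by (simp add: mult_le_0_iff)
  next
    case greater
    then have "0 \<le> b i j x' * (x' - (X t i - X t j))"
      using monoD[OF mono_psi_t[of "th i - th j"], of "X t i - X t j" x'] by (simp flip: inc)
    then show ?thesis using greater by (simp add: zero_le_mult_iff)
  qed
  have Xl: "((\<lambda>s. X s k) \<longlongrightarrow> X t k) (at t)" if "k < N" for k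
  proof -
    have "((\<lambda>s. X s k - X t k) \<longlongrightarrow> 0) (at t)"
    proof (rule pair_map_tendsto_cancel[where \<phi> = "\<lambda>_ i j s. \<psi>\<^sub>t s (th i - th j)" and w = "\<lambda>_. X t"])
      fix i
      have "((\<lambda>s. (s - t) * th i) \<longlongrightarrow> (t - t) * th i) (at t)"
        by (intro tendsto_intros)
      then show "((\<lambda>s. pair_map N (\<lambda>i j s. \<psi>\<^sub>t s (th i - th j)) (X s) i
          - pair_map N (\<lambda>i j s. \<psi>\<^sub>t s (th i - th j)) (X t) i) \<longlongrightarrow> 0) (at t)"
        unfolding freepos_def[symmetric] assms(1) by (simp add: left_diff_distrib)
    qed (use mono_psi_t that in auto)
    then show ?thesis by (simp add: LIM_zero_iff)
  qed
  define B' where "B' = (\<lambda>s i j. b i j (X s i - X s j))"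
  have nn: "nonneg N (B' s)" for s by (simp add: nonneg_def B'_def b0)
  have "((\<lambda>s. lsolve N (B' s) th i) \<longlongrightarrow> vel N (X t) th i) (at t)"
    unfolding vel_def
  proof (rule lsolve_tendsto[OF nn _ nonneg_B tendsto_const assms(2)])
    fix i j assume "i < N" "j < N"
    then show "((\<lambda>s. B' s i j) \<longlongrightarrow> B (X t) th i j) (at t)"
      unfolding B'_def b[symmetric] by (intro isCont_tendsto_compose[OF cont] tendsto_diff Xl)
  qed
  then show ?thesis unfolding has_field_derivative_iff
  proof (rule Lim_transform_eventually)
    have "\<forall>\<^sub>F s in at t. s \<noteq> t" by (simp add: eventually_at_filter)
    then show "\<forall>\<^sub>F s in at t. lsolve N (B' s) th i = (X s i - X t i) / (s - t)"
    proof eventually_elim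
      case (elim s)
      let ?d = "\<lambda>i. (X s i - X t i) / (s - t)"
      have "?d l + lap N (B' s) ?d l = th l" if l: "l < N" for l
      proof -
        have "freepos N (X s) th l - freepos N (X t) th l = (s - t) * th l"
          by (simp add: assms(1) left_diff_distrib)
        moreover have "freepos N (X s) th l - freepos N (X t) th l = (X s l - X t l)
           + (\<Sum>j<N. \<psi>\<^sub>t (X s l - X s j) (th l - th j) - \<psi>\<^sub>t (X t l - X t j) (th l - th j))"
          by (simp add: freepos_apply l sum_subtractf)
        ultimately have "(s - t) * th l = (X s l - X t l) + lap N (B' s) (\<lambda>l. X s l - X t l) l"
          unfolding inc by (simp add: lap_def B'_def algebra_simps)
        moreover have "lap N (B' s) ?d l = lap N (B' s) (\<lambda>l. X s l - X t l) l / (s - t)"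
          using lap_scale[of N "B' s" "1 / (s - t)" "\<lambda>l. X s l - X t l" l] by simp
        ultimately show ?thesis
          using elim by (simp add: add_divide_distrib[symmetric] nonzero_divide_eq_eq mult.commute)
      qed
      then show ?case by (rule lsolve_unique[OF nn _ assms(2), symmetric])
    qed
  qed
qed

text \<open>The angle vector stays \<open>th\<close> by construction, so the Hamiltonian vector
  field at the current point is \<open>vel\<close> and its Laplacian image. The former is the
  derivative of the positions, the latter follows from it by the chain rule for momenta.\<close>

lemma omega_flow:
  assumes y: "y \<in> sub N" and th: "th \<in> sub N"
  shows "hamilton_solution N (Hpsi psi N) UNIV (\<lambda>t. omega psi N (\<lambda>i. y i + t * th i) th)"
proof -
  have "\<forall>t. \<exists>x. x \<in> sub N \<and> freepos N x th = (\<lambda>i. y i + t * th i)"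
  proof
    fix t
    have "(\<lambda>i. y i + t * th i) \<in> sub N" using y th by (simp add: sub_def)
    from freepos_surj[OF this] show "\<exists>x. x \<in> sub N \<and> freepos N x th = (\<lambda>i. y i + t * th i)" by blast
  qed
  then obtain X where X: "\<And>t. X t \<in> sub N" "\<And>t. freepos N (X t) th = (\<lambda>i. y i + t * th i)"
    unfolding choice_iff by blast
  have om: "omega psi N (\<lambda>i. y i + t * th i) th = (X t, momentum N (X t) th)" for t
    using omega_freepos[OF X(1) th] unfolding X(2) .
  have dX: "((\<lambda>s. X s i) has_real_derivative vel N (X t) th i) (at t)" if "i < N" for i t
    by (rule freepos_curve_derivative[OF X(2) that])
  have dP: "((\<lambda>s. momentum N (X s) th i) has_real_derivative lap N (A (X t) th) (vel N (X t) th) i) (at t)"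
    if i: "i < N" for i t
  proof -
    have "((\<lambda>s. \<psi>\<^sub>x (X s i - X s j) (th i - th j)) has_real_derivative
        A (X t) th i j * (vel N (X t) th i - vel N (X t) th j)) (at t)" if "j < N" for j
      unfolding A_def
      by (rule DERIV_chain2[of "\<lambda>r. \<psi>\<^sub>x r (th i - th j)", OF DERIV_psi_x_x]) (intro DERIV_diff dX i that)
    then have "((\<lambda>s. th i + (\<Sum>j<N. \<psi>\<^sub>x (X s i - X s j) (th i - th j))) has_real_derivative
       0 + (\<Sum>j<N. A (X t) th i j * (vel N (X t) th i - vel N (X t) th j))) (at t)"
      by (intro DERIV_add DERIV_const DERIV_sum) auto
    then show ?thesis by (simp add: momentum_apply i lap_def)
  qed
  show ?thesis
    unfolding hamilton_solution_def om fst_conv snd_conv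
    using X(1) dX dP by (simp add: hamilton_vector_field theta_momentum th)
qed

text \<open>Uniqueness comes from conserved quantities: first \<open>theta\<close>, then
  \<open>freepos\<close> minus \<open>t * th\<close>, have zero derivative on the convex set
  \<open>J\<close>. Their constant values are the required \<open>th\<close> and
  \<open>y\<close>.\<close>

lemma hamilton_solution_is_omega_flow:
  assumes J: "is_interval J" and sol: "hamilton_solution N (Hpsi psi N) J gamma"
  shows "\<exists>y\<in>sub N. \<exists>th\<in>sub N. \<forall>t\<in>J. gamma t = omega psi N (\<lambda>i. y i + t * th i) th"
proof -
  define x where "x = (\<lambda>t. fst (gamma t))"
  define p where "p = (\<lambda>t. snd (gamma t))"
  define T where "T = (\<lambda>t. theta psi N (x t) (p t))"
  have sub: "x t \<in> sub N" "p t \<in> sub N" if "t \<in> J" for t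
    using sol that by (auto simp: hamilton_solution_def x_def p_def mem_Times_iff)
  have dx: "((\<lambda>s. x s i) has_real_derivative vel N (x t) (T t) i) (at t within J)" if "t \<in> J" "i < N" for t i
    using sol that unfolding T_def hamilton_vector_field(1)[OF sub[OF that(1)] that(2), symmetric]
    by (simp add: hamilton_solution_def x_def p_def)
  have dp: "((\<lambda>s. p s i) has_real_derivative lap N (A (x t) (T t)) (vel N (x t) (T t)) i) (at t within J)"
    if "t \<in> J" "i < N" for t i
    using sol that unfolding T_def hamilton_vector_field(2)[OF sub[OF that(1)] that(2), symmetric]
    by (simp add: hamilton_solution_def x_def p_def)
  have conv: "convex J" using J by (rule is_interval_convex)
  have "\<exists>c. \<forall>t\<in>J. T t i = c" if i: "i < N" for i
  proof (rule has_field_derivative_zero_constant[OF conv])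
    fix t assume t: "t \<in> J"
    let ?B = "B (x t) (T t)" and ?A = "A (x t) (T t)" and ?v = "vel N (x t) (T t)"
    have "((\<lambda>s. theta psi N (x s) (p s) i) has_real_derivative
      (\<Sum>k<N. - lsolve N ?B (lap N ?A (unitv k)) i * ?v k + lsolve N ?B (unitv k) i * lap N ?A ?v k)) (at t within J)"
      using cdiff_curve[OF theta_cdiff[OF sub[OF t] i] dx[OF t] dp[OF t] _ t] sub
      unfolding T_def by blast
    moreover have "(\<Sum>k<N. - lsolve N ?B (lap N ?A (unitv k)) i * ?v k + lsolve N ?B (unitv k) i * lap N ?A ?v k)
       = (\<Sum>k<N. lap N ?A ?v k * lsolve N ?B (unitv k) i) - (\<Sum>k<N. ?v k * lsolve N ?B (lap N ?A (unitv k)) i)"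
      unfolding sum_subtractf[symmetric] by (intro sum.cong refl) simp
    \<comment> \<open>Both sums expand the same solution in unit vectors, so the contribution of the
      moving momenta cancels that of the moving positions.\<close>
    moreover have "lsolve N ?B (lap N ?A ?v) i = (\<Sum>k<N. lap N ?A ?v k * lsolve N ?B (unitv k) i)"
      unfolding lsolve_sum[OF nonneg_B i, symmetric]
      by (rule fun_cong[OF lsolve_cong]) (simp add: unitv_expand)
    moreover have "lsolve N ?B (lap N ?A ?v) i = (\<Sum>k<N. ?v k * lsolve N ?B (lap N ?A (unitv k)) i)"
      unfolding lsolve_sum[OF nonneg_B i, symmetric]
      by (rule fun_cong[OF lsolve_cong]) (rule lap_expand)
    ultimately show "((\<lambda>t. T t i) has_real_derivative 0) (at t within J)"
      unfolding T_def by simp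
  qed
  then obtain c where c: "\<And>i t. i < N \<Longrightarrow> t \<in> J \<Longrightarrow> T t i = c i" by metis
  define th where "th = (\<lambda>i. if i < N then c i else 0)"
  have th: "th \<in> sub N" by (simp add: th_def sub_def)
  have T: "T t = th" if "t \<in> J" for t
    by (rule sub_eqI[OF _ th]) (use c that theta_in_sub[OF sub[OF that]] in \<open>auto simp: th_def T_def\<close>)
  \<comment> \<open>With \<open>th\<close> constant only the positions vary, and the defining
    equation of \<open>vel\<close> says that \<open>freepos\<close> grows at rate
    \<open>th\<close>.\<close>
  have "\<exists>c. \<forall>t\<in>J. freepos N (x t) th i - t * th i = c" if i: "i < N" for i
  proof (rule has_field_derivative_zero_constant[OF conv])
    fix t assume t: "t \<in> J"
    let ?v = "vel N (x t) th"
    have dx': "((\<lambda>s. x s i) has_real_derivative ?v i) (at t within J)" if "i < N" for i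
      using dx[OF t that] T[OF t] by simp
    have "((\<lambda>s. \<psi>\<^sub>t (x s i - x s j) (th i - th j)) has_real_derivative
        B (x t) th i j * (?v i - ?v j)) (at t within J)" if "j < N" for j
      unfolding B_def
      by (rule DERIV_chain2[of "\<lambda>r. \<psi>\<^sub>t r (th i - th j)", OF DERIV_psi_t_x]) (intro DERIV_diff dx' i that)
    then have "((\<lambda>s. x s i + (\<Sum>j<N. \<psi>\<^sub>t (x s i - x s j) (th i - th j)) - s * th i) has_real_derivative
       ?v i + (\<Sum>j<N. B (x t) th i j * (?v i - ?v j)) - 1 * th i) (at t within J)"
      by (intro DERIV_diff DERIV_add dx' i DERIV_sum DERIV_cmult_right DERIV_ident) auto
    moreover have "?v i + (\<Sum>j<N. B (x t) th i j * (?v i - ?v j)) = th i"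
      using lsolve_eq[OF nonneg_B i, of "x t" th th] by (simp add: vel_def lap_def)
    ultimately show "((\<lambda>t. freepos N (x t) th i - t * th i) has_real_derivative 0) (at t within J)"
      by (simp add: freepos_apply i)
  qed
  then obtain y0 where y0: "\<And>i t. i < N \<Longrightarrow> t \<in> J \<Longrightarrow> freepos N (x t) th i - t * th i = y0 i" by metis
  define y where "y = (\<lambda>i. if i < N then y0 i else 0)"
  have y: "y \<in> sub N" by (simp add: y_def sub_def)
  have "gamma t = omega psi N (\<lambda>i. y i + t * th i) th" if t: "t \<in> J" for t
  proof -
    have "freepos N (x t) th = (\<lambda>i. y i + t * th i)"
    proof (rule sub_eqI[of _ N])
      show "(\<lambda>i. y i + t * th i) \<in> sub N" using y th by (simp add: sub_def)
      fix i assume "i < N"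
      then show "freepos N (x t) th i = y i + t * th i"
        using y0[of i t] t by (simp add: y_def)
    qed simp
    then have "omega psi N (\<lambda>i. y i + t * th i) th = (x t, momentum N (x t) th)"
      using omega_freepos[OF sub(1)[OF t] th] by simp
    also have "momentum N (x t) th = p t"
      using momentum_theta[OF sub[OF t]] T[OF t] by (simp add: T_def)
    finally show ?thesis by (simp add: x_def p_def)
  qed
  then show ?thesis using y th by blast
qed

end

section \<open>Finite range\<close>

lemma sum_restr:
  assumes "finite I"
  shows "(\<Sum>k<card I. h (sorted_list_of_set I ! k)) = (\<Sum>i\<in>I. h i)"
  by (rule sum.reindex_bij_betw[OF bij_betw_nth]) (use assms in auto)

lemma restr_in_sub: "restr I v \<in> sub (card I)"
  by (simp add: restr_def sub_def)

lemma sorted_list_of_set_nth_mem: "finite I \<Longrightarrow> k < card I \<Longrightarrow> sorted_list_of_set I ! k \<in> I"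
  by (metis length_sorted_list_of_set nth_mem set_sorted_list_of_set)

text \<open>Classes of the reflexive transitive closure are disjoint, and those of indices below
  \<open>N\<close> stay below \<open>N\<close> because every edge does. An edge leaving a class
  would enlarge it, which gives the separation.\<close>

lemma
  fixes x :: "nat \<Rightarrow> real"
  shows cluster_subset: "I \<in> cluster_partition eps N x \<Longrightarrow> I \<subseteq> {..<N}"
    and cluster_separated: "I \<in> cluster_partition eps N x \<Longrightarrow> i \<in> I \<Longrightarrow> j < N \<Longrightarrow> j \<notin> I
          \<Longrightarrow> eps < \<bar>x i - x j\<bar>"
    and cluster_sum: "(\<Sum>i<N. g i) = (\<Sum>I\<in>cluster_partition eps N x. \<Sum>i\<in>I. (g i :: real))"
proof -
  define R where "R = {(i, j). i < N \<and> j < N \<and> \<bar>x i - x j\<bar> \<le> eps}"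
  have P: "cluster_partition eps N x = {0..<N} // R\<^sup>*"
    by (simp add: cluster_partition_def R_def)
  have stay: "j < N" if "(i, j) \<in> R\<^sup>*" "i < N" for i j
    using that by (induction rule: rtrancl_induct) (auto simp: R_def)
  have subset: "I \<subseteq> {..<N}" if "I \<in> cluster_partition eps N x" for I
    using that stay unfolding P by (auto elim!: quotientE)
  then show "I \<in> cluster_partition eps N x \<Longrightarrow> I \<subseteq> {..<N}" .
  have "sym R" by (auto simp: R_def sym_def)
  \<comment> \<open>Taken on all naturals, where the closure is reflexive; indices from
    \<open>N\<close> on form singleton classes outside the partition.\<close>
  then have equiv: "equiv UNIV (R\<^sup>*)"
    by (intro equivI refl_rtrancl sym_rtrancl trans_rtrancl) auto
  show "eps < \<bar>x i - x j\<bar>" if I: "I \<in> cluster_partition eps N x" and ij: "i \<in> I" "j < N" "j \<notin> I"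
  proof (rule ccontr)
    assume "\<not> eps < \<bar>x i - x j\<bar>"
    then have "(i, j) \<in> R" using subset[OF I] ij by (auto simp: R_def)
    moreover obtain k where k: "I = R\<^sup>* `` {k}" using I unfolding P by (auto elim!: quotientE)
    ultimately have "(k, j) \<in> R\<^sup>*" using ij(1) by (auto intro: rtrancl_into_rtrancl)
    then show False using k ij(3) by auto
  qed
  have Un: "\<Union>(cluster_partition eps N x) = {..<N}"
  proof
    show "\<Union>(cluster_partition eps N x) \<subseteq> {..<N}" using subset by blast
    show "{..<N} \<subseteq> \<Union>(cluster_partition eps N x)"
    proof
      fix i assume "i \<in> {..<N}"
      then have "R\<^sup>* `` {i} \<in> cluster_partition eps N x" unfolding P by (auto intro: quotientI)
      then show "i \<in> \<Union>(cluster_partition eps N x)" by blast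
    qed
  qed
  have disj: "I \<inter> I' = {}" if "I \<in> cluster_partition eps N x" "I' \<in> cluster_partition eps N x" "I \<noteq> I'" for I I'
  proof -
    have "I \<in> UNIV // R\<^sup>*" "I' \<in> UNIV // R\<^sup>*"
      using that unfolding P by (auto simp: quotient_def)
    then show ?thesis using quotient_disj[OF equiv] that(3) by blast
  qed
  have "sum g (\<Union>(cluster_partition eps N x)) = (sum \<circ> sum) g (cluster_partition eps N x)"
  proof (rule sum.Union_disjoint)
    show "\<forall>A\<in>cluster_partition eps N x. finite A"
      using subset finite_subset by blast
    show "\<forall>A\<in>cluster_partition eps N x. \<forall>B\<in>cluster_partition eps N x. A \<noteq> B \<longrightarrow> A \<inter> B = {}"
      using disj by blast
  qed
  then show "(\<Sum>i<N. g i) = (\<Sum>I\<in>cluster_partition eps N x. \<Sum>i\<in>I. g i)"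
    by (simp add: Un)
qed

text \<open>The terms linking \<open>I\<close> to its complement vanish, so the restricted
  \<open>theta\<close> solves the momentum equation of the system of \<open>card I\<close>
  particles; uniqueness identifies it.\<close>

lemma (in interaction) theta_restr:
  assumes sub: "x \<in> sub N" "p \<in> sub N" and I: "I \<subseteq> {..<N}"
    and sep: "\<And>i j t. i \<in> I \<Longrightarrow> j < N \<Longrightarrow> j \<notin> I \<Longrightarrow> \<psi>\<^sub>x (x i - x j) t = 0"
  shows "theta psi (card I) (restr I x) (restr I p) = restr I (theta psi N x p)"
proof -
  let ?th = "theta psi N x p" and ?s = "sorted_list_of_set I"
  have fin: "finite I" using I finite_subset by blast
  have "momentum (card I) (restr I x) (restr I ?th) = restr I p"
  proof (rule sub_eqI[OF momentum_in_sub restr_in_sub])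
    fix k assume k: "k < card I"
    define i where "i = ?s ! k"
    have i: "i \<in> I" "i < N"
      using sorted_list_of_set_nth_mem[OF fin k] I by (auto simp: i_def)
    have "momentum (card I) (restr I x) (restr I ?th) k
        = ?th i + (\<Sum>l<card I. \<psi>\<^sub>x (x i - x (?s ! l)) (?th i - ?th (?s ! l)))"
      using k by (simp add: momentum_apply restr_def i_def)
    also have "\<dots> = ?th i + (\<Sum>j\<in>I. \<psi>\<^sub>x (x i - x j) (?th i - ?th j))"
      by (simp add: sum_restr[OF fin, of "\<lambda>j. \<psi>\<^sub>x (x i - x j) (?th i - ?th j)"])
    also have "\<dots> = ?th i + (\<Sum>j<N. \<psi>\<^sub>x (x i - x j) (?th i - ?th j))"
      using sep[OF i(1)] I by (intro arg_cong2[where f = "(+)"] refl sum.mono_neutral_left) auto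
    also have "\<dots> = p i"
      using momentum_theta_apply[OF sub i(2)] by (rule sym)
    also have "\<dots> = restr I p k"
      using k by (simp add: restr_def i_def)
    finally show "momentum (card I) (restr I x) (restr I ?th) k = restr I p k" .
  qed
  then show ?thesis
    using theta_momentum[OF restr_in_sub restr_in_sub, of I x ?th] by simp
qed

section \<open>Zero interaction and the power sums of the momenta\<close>

lemma interaction_zero: "interaction (\<lambda>_ _. 0)"
proof -
  have "pdx (\<lambda>_ _. 0) = (\<lambda>_ _. 0)" "pdt (\<lambda>_ _. 0) = (\<lambda>_ _. 0)"
    by (simp_all add: pdx_def pdt_def fun_eq_iff)
  then show ?thesis
    by unfold_locales (auto simp: C2_def partials_exist_def)
qed

interpretation zero: interaction "\<lambda>_ _. 0"
  by (rule interaction_zero)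

text \<open>The free particles, treated as the case of zero interaction.\<close>

lemma Qpsi_zero:
  assumes "x \<in> sub N" "p \<in> sub N"
  shows "Qpsi (\<lambda>_ _. 0) N a x p = (\<Sum>i<N. p i ^ a)"
proof -
  have "zero.momentum N x p = p"
    by (rule sub_eqI[OF zero.momentum_in_sub assms(2)]) (simp add: zero.momentum_apply pdx_def)
  then have "theta (\<lambda>_ _. 0) N x p = p"
    using zero.theta_momentum[OF assms] by simp
  then show ?thesis by (simp add: Qpsi_def)
qed

text \<open>The power sums agree with the zero-interaction \<open>Qpsi\<close> only on phase space.
  Coordinate lines with \<open>k < N\<close> remain there, so the partial derivatives agree and the
  independence carries over.\<close>

lemma power_sum_func_indep: "func_indep N (\<lambda>a x p. \<Sum>i<N. p i ^ a)"
proof -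
  have "pdX (\<lambda>x p. \<Sum>i<N. p i ^ a) k x p = pdX (Qpsi (\<lambda>_ _. 0) N a) k x p"
    "pdP (\<lambda>x p. \<Sum>i<N. p i ^ a) k x p = pdP (Qpsi (\<lambda>_ _. 0) N a) k x p"
    if "x \<in> sub N" "p \<in> sub N" "k < N" for a k x p
    unfolding pdX_def pdP_def using that by (simp_all add: Qpsi_zero sub_upd)
  note eq = this
  obtain S where S: "openin (top_of_set (sub N \<times> sub N)) S" "sub N \<times> sub N \<subseteq> closure S"
    and ind: "\<forall>(x, p)\<in>S. \<forall>c. (\<forall>k<N. (\<Sum>a=1..N. c a * pdX (Qpsi (\<lambda>_ _. 0) N a) k x p) = 0 \<and>
       (\<Sum>a=1..N. c a * pdP (Qpsi (\<lambda>_ _. 0) N a) k x p) = 0) \<longrightarrow> (\<forall>a\<in>{1..N}. c a = 0)"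
    using zero.Qpsi_func_indep[of N] unfolding func_indep_def by blast
  have "\<forall>a\<in>{1..N}. c a = 0" if xp: "(x, p) \<in> S"
    and c: "\<forall>k<N. (\<Sum>a=1..N. c a * pdX (\<lambda>x p. \<Sum>i<N. p i ^ a) k x p) = 0 \<and>
       (\<Sum>a=1..N. c a * pdP (\<lambda>x p. \<Sum>i<N. p i ^ a) k x p) = 0" for x p c
  proof -
    have "x \<in> sub N" "p \<in> sub N" using openin_imp_subset[OF S(1)] xp by blast+
    then have "\<forall>k<N. (\<Sum>a=1..N. c a * pdX (Qpsi (\<lambda>_ _. 0) N a) k x p) = 0 \<and>
       (\<Sum>a=1..N. c a * pdP (Qpsi (\<lambda>_ _. 0) N a) k x p) = 0"
      using c by (simp add: eq)
    then show ?thesis using ind xp by blast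
  qed
  then show ?thesis unfolding func_indep_def using S by blast
qed

section \<open>Quasi-potentials and their decomposition over clusters\<close>

context interaction
begin

text \<open>The particle number is an argument: the same family supplies both the full
  \<open>V_a\<close> and its cluster functions \<open>V_a^(n)\<close>, which is the uniformity in
  \<open>N\<close>.\<close>

definition quasi_potential :: "nat \<Rightarrow> nat \<Rightarrow> phasefun" where
  "quasi_potential a N x p = Qpsi psi N a x p - (\<Sum>i<N. p i ^ a)"

text \<open>On phase space it is the difference of \<open>Qpsi\<close> for \<open>psi\<close> and
  for the zero interaction, both with explicit continuous gradients.\<close>

lemma quasi_potential_C1: "C1 N (quasi_potential a N)"
proof -
  let ?f = "\<lambda>t :: real. real a * t ^ (a - 1)"
  let ?t = "\<lambda>x p. theta psi N x p" and ?s = "\<lambda>x p. theta (\<lambda>_ _. 0) N x p"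
  let ?u = "\<lambda>x p. lsolve N (B x (?t x p)) (\<lambda>i. ?f (?t x p i))"
  let ?w = "\<lambda>x p. lsolve N (zero.B x (?s x p)) (\<lambda>i. ?f (?s x p i))"
  have cont: "continuous_on UNIV ?f" by (intro continuous_intros)
  show ?thesis
  proof (rule C1_I[where
        gx = "\<lambda>x p k. - lap N (A x (?t x p)) (?u x p) k - (- lap N (zero.A x (?s x p)) (?w x p) k)" and
        gp = "\<lambda>x p k. ?u x p k - ?w x p k"])
    fix x p assume sub: "x \<in> sub N" "p \<in> sub N"
    show "cdiff N (quasi_potential a N) x p (\<lambda>k. - lap N (A x (?t x p)) (?u x p) k - (- lap N (zero.A x (?s x p)) (?w x p) k))
       (\<lambda>k. ?u x p k - ?w x p k)"
      by (rule cdiff_cong_fun[OF cdiff_diff[OF Qpsi_cdiff[OF sub] zero.Qpsi_cdiff[OF sub]] sub])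
         (simp add: quasi_potential_def Qpsi_zero)
  next
    fix x p k assume sub: "x \<in> sub N" "p \<in> sub N" and k: "k < N"
    show "((\<lambda>z. - lap N (A (fst z) (?t (fst z) (snd z))) (?u (fst z) (snd z)) k
          - (- lap N (zero.A (fst z) (?s (fst z) (snd z))) (?w (fst z) (snd z)) k)) \<longlongrightarrow>
        - lap N (A x (?t x p)) (?u x p) k - (- lap N (zero.A x (?s x p)) (?w x p) k)) (near N x p)"
      by (intro tendsto_diff sum_theta_grad_tendsto(2)[OF sub cont k]
          zero.sum_theta_grad_tendsto(2)[OF sub cont k])
    show "((\<lambda>z. ?u (fst z) (snd z) k - ?w (fst z) (snd z) k) \<longlongrightarrow> ?u x p k - ?w x p k) (near N x p)"
      by (intro tendsto_diff sum_theta_grad_tendsto(1)[OF sub cont k]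
          zero.sum_theta_grad_tendsto(1)[OF sub cont k])
  qed
qed

lemma quasi_potential_finite_range:
  assumes range: "\<And>x t. \<bar>x\<bar> \<ge> eps \<Longrightarrow> \<psi>\<^sub>x x t = 0"
  shows "finite_range_with eps N (\<lambda>x p. Qpsi psi N a x p - (\<Sum>i<N. p i ^ a)) (quasi_potential a)"
  unfolding finite_range_with_def quasi_potential_def[symmetric, abs_def]
proof (intro conjI ballI quasi_potential_C1)
  fix x p :: "nat \<Rightarrow> real" assume sub: "x \<in> sub 1" "p \<in> sub 1"
  \<comment> \<open>For one particle only the diagonal term \<open>\<psi>\<^sub>x 0 0 = 0\<close> is
    left.\<close>
  have "p 0 = theta psi 1 x p 0"
    using momentum_theta_apply[OF sub, of 0] by simp
  then show "quasi_potential a 1 x p = 0" by (simp add: quasi_potential_def Qpsi_def)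
next
  fix x p assume sub: "x \<in> sub N" "p \<in> sub N"
  let ?C = "cluster_partition eps N x" and ?th = "theta psi N x p"
  have "quasi_potential a N x p = (\<Sum>i<N. ?th i ^ a - p i ^ a)"
    by (simp add: quasi_potential_def Qpsi_def sum_subtractf)
  also have "\<dots> = (\<Sum>I\<in>?C. \<Sum>i\<in>I. ?th i ^ a - p i ^ a)"
    by (rule cluster_sum)
  also have "\<dots> = (\<Sum>I\<in>?C. quasi_potential a (card I) (restr I x) (restr I p))"
  proof (rule sum.cong[OF refl])
    fix I assume I: "I \<in> ?C"
    have fin: "finite I" using cluster_subset[OF I] finite_subset by blast
    \<comment> \<open>Distinct clusters are more than \<open>eps\<close> apart, where the range
      hypothesis applies.\<close>
    have "\<psi>\<^sub>x (x i - x j) t = 0" if "i \<in> I" "j < N" "j \<notin> I" for i j t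
      using cluster_separated[OF I that] by (intro range) simp
    then have th: "theta psi (card I) (restr I x) (restr I p) = restr I ?th"
      by (rule theta_restr[OF sub cluster_subset[OF I]])
    have "quasi_potential a (card I) (restr I x) (restr I p)
      = (\<Sum>k<card I. ?th (sorted_list_of_set I ! k) ^ a - p (sorted_list_of_set I ! k) ^ a)"
      unfolding quasi_potential_def Qpsi_def th by (simp add: restr_def sum_subtractf)
    also have "\<dots> = (\<Sum>i\<in>I. ?th i ^ a - p i ^ a)"
      by (rule sum_restr[OF fin])
    finally show "(\<Sum>i\<in>I. ?th i ^ a - p i ^ a) = quasi_potential a (card I) (restr I x) (restr I p)" by simp
  qed
  finally show "quasi_potential a N x p = (\<Sum>I\<in>?C. quasi_potential a (card I) (restr I x) (restr I p))" .
qed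

end

theorem theorem1:
  fixes eps :: real and psi :: "real \<Rightarrow> real \<Rightarrow> real"
  assumes eps_pos: "eps > 0"
    and psi_C2: "C2 psi"
    and psi_xtheta: "\<forall>x t. pdt (pdx psi) x t \<ge> 0"
    and psi_sym: "\<forall>x t. psi (- x) (- t) = psi x t"
    and psi_range: "\<forall>x t. \<bar>x\<bar> \<ge> eps \<longrightarrow> pdx psi x t = 0"
  shows "(\<forall>N\<ge>1.
            C1 N (Hpsi psi N) \<and>
            (\<forall>y\<in>sub N. \<forall>th\<in>sub N.
               hamilton_solution N (Hpsi psi N) UNIV (\<lambda>t. omega psi N (\<lambda>i. y i + t * th i) th)) \<and>
            (\<forall>J gamma. open J \<and> is_interval J \<and> J \<noteq> {} \<and>
               hamilton_solution N (Hpsi psi N) J gamma \<longrightarrow>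
               (\<exists>y\<in>sub N. \<exists>th\<in>sub N. \<forall>t\<in>J. gamma t = omega psi N (\<lambda>i. y i + t * th i) th)) \<and>
            (\<forall>a\<in>{1..N}. C1 N (Qpsi psi N a)) \<and>
            func_indep N (Qpsi psi N) \<and>
            (\<forall>a\<in>{1..N}. \<forall>b\<in>{1..N}. \<forall>x\<in>sub N. \<forall>p\<in>sub N.
               pbracket N (Qpsi psi N a) (Qpsi psi N b) x p = 0) \<and>
            (\<forall>x\<in>sub N. \<forall>p\<in>sub N. Hpsi psi N x p = (1/2) * Qpsi psi N 2 x p) \<and>
            liouville_with N (Hpsi psi N) (Qpsi psi N) \<and>
            liouville_integrable N (Hpsi psi N))
       \<and> liouville_finite_range eps (Hpsi psi) (\<lambda>a p. p ^ a)
       \<and> (\<exists>W :: nat \<Rightarrow> nat \<Rightarrow> phasefun. \<forall>N\<ge>1. \<forall>a\<in>{1..N}.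
            finite_range_with eps N (\<lambda>x p. Qpsi psi N a x p - (\<Sum>i<N. p i ^ a)) (W a))"
proof -
  interpret interaction psi
    using psi_C2 psi_xtheta psi_sym by unfold_locales auto
  have range: "finite_range_with eps N (\<lambda>x p. Qpsi psi N a x p - (\<Sum>i<N. p i ^ a)) (quasi_potential a)" for N a
    by (rule quasi_potential_finite_range) (use psi_range in auto)
  have integrable: "liouville_integrable N (Hpsi psi N)" for N
    using Hpsi_liouville unfolding liouville_integrable_def by blast
  have half: "Hpsi psi N x p = (1/2) * Qpsi psi N 2 x p" for N x p
    by (simp add: Hpsi_def Qpsi_def)
  have flow: "\<exists>y\<in>sub N. \<exists>th\<in>sub N. \<forall>t\<in>J. gamma t = omega psi N (\<lambda>i. y i + t * th i) th"
    if "open J \<and> is_interval J \<and> J \<noteq> {} \<and> hamilton_solution N (Hpsi psi N) J gamma" for N J gamma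
    using that by (intro hamilton_solution_is_omega_flow) auto
  have C1_power: "real_C1 (\<lambda>p. p ^ a)" for a
    unfolding real_C1_def
    by (intro exI[of _ "\<lambda>t. real a * t ^ (a - 1)"] conjI allI DERIV_power_nat continuous_intros)
  \<comment> \<open>The witnesses are \<open>Qpsi psi N\<close> for the conserved quantities and
    \<open>quasi_potential\<close> for the family \<open>W\<close>, chosen before
    \<open>N\<close>.\<close>
  have "liouville_finite_range eps (Hpsi psi) (\<lambda>a p. p ^ a)"
    unfolding liouville_finite_range_def
    using C1_power power_sum_func_indep Hpsi_liouville range by blast
  moreover have "\<exists>W. \<forall>N\<ge>1. \<forall>a\<in>{1..N}.
      finite_range_with eps N (\<lambda>x p. Qpsi psi N a x p - (\<Sum>i<N. p i ^ a)) (W a)"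
    using range by blast
  ultimately show ?thesis
    using Hpsi_C1 omega_flow flow Qpsi_C1 Qpsi_func_indep Qpsi_pbracket half Hpsi_liouville integrable
    by (intro conjI allI impI ballI) auto
qed

end
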